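(* Let $A$ be a commutative Frobenius algebra over a commutative unital ring $k$ with handle element $\phi=\mu_A\Delta_A(1)$, such that there exists an element $\xi\in A$ with $\xi^2=\phi$. Then there exists a commutative Frobenius pair $(A,E)$ with Möbius maps.
   Context: All tensor products are over the commutative unital ring $k$. $\mathrm{id}_A,\mathrm{id}_E$ are identity maps. For multiplications the subscripts give the source and the superscript the target; for comultiplications the subscript is the source and the superscripts the target. Frobenius algebra. A commutative Frobenius algebra $A$ over $k$ has multiplication $\mu_A$, unit $\eta_A$, counit $\epsilon_A:A\to k$, nondegenerate associative pairing $\beta(x\otimes y)=\epsilon_A(xy)$, and copairing $\gamma:k\to A\otimes A$ with $(\beta\otimes\mathrm{id})(\mathrm{id}\otimes\gamma)=\mathrm{id}=(\mathrm{id}\otimes\beta)(\gamma\otimes\mathrm{id})$; its comultiplication is $\Delta_A=(\mu_A\otimes\mathrm{id})(\mathrm{id}\otimes\gamma)=(\mathrm{id}\otimes\mu_A)(\gamma\otimes\mathrm{id})$. Commutative Frobenius pair $(A,E)$ over $k$: (i) $A$ is a commutative Frobenius algebra over $k$. (ii) $E$ is an $A$-bimodule (associative, unital) and $A$-bicomodule (coassociative, counital) with the same right and left actions and coactions: actions $\mu_{A,E}^E:A\otimes E\to E$, $\mu_{E,A}^E:E\otimes A\to E$ with $ax=xa$; coactions $\Delta_E^{A,E}:E\to A\otimes E$, $\Delta_E^{E,A}:E\to E\otimes A$ related by the transposition. (iii) $(\beta\otimes\mathrm{id}_E)(\mathrm{id}_A\otimes\Delta_E^{A,E})=\mu_{A,E}^E$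 and $(\mathrm{id}_A\otimes\mu_{A,E}^E)(\gamma\otimes\mathrm{id}_E)=\Delta_E^{A,E}$. (iv) There are an associative commutative $\mu_E=\mu_{E,E}^E:E\otimes E\to E$ and a coassociative cocommutative $\Delta_E=\Delta_E^{E,E}:E\to E\otimes E$ that are $A$-bimodule and $A$-bicomodule maps, with $(\mathrm{id}\otimes\mu_E)(\Delta_E\otimes\mathrm{id})=\Delta_E\mu_E=(\mu_E\otimes\mathrm{id})(\mathrm{id}\otimes\Delta_E)$. (v) There are $A$-bimodule, $A$-bicomodule maps $\mu_{E,E}^A:E\otimes E\to A$ (commutative) and $\Delta_A^{E,E}:A\to E\otimes E$ (cocommutative) with $\mu_{A,E}^E(\mu_{E,E}^A\otimes\mathrm{id}_E)=\mu_{E,A}^E(\mathrm{id}_E\otimes\mu_{E,E}^A)$, $\mu_{E,E}^A(\mu_E\otimes\mathrm{id}_E)=\mu_{E,E}^A(\mathrm{id}_E\otimes\mu_E)$, $(\Delta_A^{E,E}\otimes\mathrm{id}_E)\Delta_E^{A,E}=(\mathrm{id}_E\otimes\Delta_A^{E,E})\Delta_E^{E,A}$, $(\Delta_E\otimes\mathrm{id}_E)\Delta_A^{E,E}=(\mathrm{id}_E\otimes\Delta_E)\Delta_A^{E,E}$. In (iv),(v), $E\otimes E$ has left (co)action on its left factor and right (co)action on its right factor. (vi) Compatibility: $\Delta_E^{A,E}\mu_{A,E}^E=(\mathrm{id}_A\otimes\mu_{A,E}^E)(\Delta_A\otimes\mathrm{id}_E)=(\mu_A\otimes\mathrm{id}_E)(\mathrm{id}_A\otimes\Delta_E^{A,E})$;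 $\Delta_E^{A,E}\mu_E=(\mathrm{id}_A\otimes\mu_E)(\Delta_E^{A,E}\otimes\mathrm{id}_E)$; $\Delta_E\mu_{A,E}^E=(\mu_{A,E}^E\otimes\mathrm{id}_E)(\mathrm{id}_A\otimes\Delta_E)$; $\Delta_A^{E,E}\mu_{E,E}^A=(\mathrm{id}_E\otimes\mu_{A,E}^E)(\Delta_E^{E,A}\otimes\mathrm{id}_E)=(\mu_{E,A}^E\otimes\mathrm{id}_E)(\mathrm{id}_E\otimes\Delta_E^{A,E})$; together with the left-right mirror images of these equalities. (vii) Consistency: $\mu_{A,E}^E(\mu_{E,E}^A\otimes\mathrm{id}_E)=\mu_E(\mu_E\otimes\mathrm{id}_E)$; $\Delta_A^{E,E}\mu_{E,E}^A=\Delta_E\mu_E$; $\mu_{A,E}^E\Delta_E^{A,E}=\mu_E\Delta_E$. Möbius maps for $(A,E)$: $k$-linear maps $\nu_A^E:A\to E$, $\nu_E^A:E\to A$, $\nu_E^E:E\to E$ with $\nu_E^A\nu_A^E=\mu_A\Delta_A=\mu_{E,E}^A\Delta_A^{E,E}$; $(\nu_E^E)^2=\mu_E\Delta_E$; $\mu_{E,A}^E(\nu_A^E\otimes\mathrm{id}_A)=\nu_A^E\mu_A$; $(\nu_E^A\otimes\mathrm{id}_A)\Delta_E^{E,A}=\Delta_A\nu_E^A$; $\mu_A(\nu_E^A\otimes\mathrm{id}_A)=\nu_E^A\mu_{E,A}^E$; $(\nu_A^E\otimes\mathrm{id}_A)\Delta_A=\Delta_E^{E,A}\nu_A^E$; $\mu_{E,E}^A(\nu_A^E\otimes\mathrm{id}_E)=\mu_A(\mathrm{id}_A\otimes\nu_E^A)$;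 $(\nu_E^A\otimes\mathrm{id}_E)\Delta_A^{E,E}=(\mathrm{id}_A\otimes\nu_A^E)\Delta_A$; $\mu_E(\nu_A^E\otimes\mathrm{id}_E)=\nu_E^E\mu_{A,E}^E$; $(\nu_E^A\otimes\mathrm{id}_E)\Delta_E=\Delta_E^{A,E}\nu_E^E$; $\nu_E^A\mu_E=\mu_{E,E}^A(\nu_E^E\otimes\mathrm{id}_E)$; $\Delta_E\nu_A^E=(\nu_E^E\otimes\mathrm{id}_E)\Delta_A^{E,E}$; $\mu_{A,E}^E(\mathrm{id}_A\otimes\nu_E^E)=\nu_E^E\mu_{A,E}^E$; $(\mathrm{id}_A\otimes\nu_E^E)\Delta_E^{A,E}=\Delta_E^{A,E}\nu_E^E$; $\mu_E(\nu_E^E\otimes\mathrm{id}_E)=\nu_E^E\mu_E$; $(\nu_E^E\otimes\mathrm{id}_E)\Delta_E=\Delta_E\nu_E^E$. *)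

theory Defs
  imports "HOL-Algebra.Free_Abelian_Groups" "HOL-Algebra.Module"
begin

section \<open>Linear maps and tensor products of modules over a commutative ring\<close>

text \<open>
  Modules are the record-based modules of HOL-Algebra, so a linear map is a HOL function of which
  only the values on the carrier matter; an equation between linear maps with source \<open>M\<close> is an
  equation on the carrier of \<open>M\<close>, written \<open>f \<doteq>\<^bsub>M\<^esub> g\<close>.
\<close>

definition map_eq :: "('a, 'm) partial_object_scheme \<Rightarrow> ('a \<Rightarrow> 'b) \<Rightarrow> ('a \<Rightarrow> 'b) \<Rightarrow> bool"
    (infix \<open>\<doteq>\<index>\<close> 50)
  where "f \<doteq>\<^bsub>M\<^esub> g \<longleftrightarrow> (\<forall>x \<in> carrier M. f x = g x)"

definition module_hom ::
    "('k, 'r) ring_scheme \<Rightarrow> ('k, 'a, 'm) module_scheme \<Rightarrow> ('k, 'b, 'n) module_scheme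
      \<Rightarrow> ('a \<Rightarrow> 'b) set"
  where "module_hom k M N = {f \<in> carrier M \<rightarrow> carrier N.
     (\<forall>x \<in> carrier M. \<forall>y \<in> carrier M. f (x \<oplus>\<^bsub>M\<^esub> y) = f x \<oplus>\<^bsub>N\<^esub> f y) \<and>
     (\<forall>r \<in> carrier k. \<forall>x \<in> carrier M. f (r \<odot>\<^bsub>M\<^esub> x) = r \<odot>\<^bsub>N\<^esub> f x)}"

definition scalars :: "('k, 'r) ring_scheme \<Rightarrow> ('k, 'k) module"
  where "scalars k = \<lparr>carrier = carrier k, mult = mult k, one = \<one>\<^bsub>k\<^esub>, zero = \<zero>\<^bsub>k\<^esub>,
     add = add k, smult = mult k\<rparr>"

text \<open>
  The tensor product of \<open>M\<close> and \<open>N\<close> is the quotient of the free abelian group on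
  \<open>carrier M \<times> carrier N\<close> by the usual relations; its elements are cosets.
\<close>

definition tensor_relations ::
    "('k, 'r) ring_scheme \<Rightarrow> ('k, 'a, 'm) module_scheme \<Rightarrow> ('k, 'b, 'n) module_scheme
      \<Rightarrow> ('a \<times> 'b \<Rightarrow>\<^sub>0 int) set"
  where "tensor_relations k M N =
     {frag_of (x \<oplus>\<^bsub>M\<^esub> x', y) - frag_of (x, y) - frag_of (x', y) | x x' y.
        x \<in> carrier M \<and> x' \<in> carrier M \<and> y \<in> carrier N} \<union>
     {frag_of (x, y \<oplus>\<^bsub>N\<^esub> y') - frag_of (x, y) - frag_of (x, y') | x y y'.
        x \<in> carrier M \<and> y \<in> carrier N \<and> y' \<in> carrier N} \<union>
     {frag_of (r \<odot>\<^bsub>M\<^esub> x, y) - frag_of (x, r \<odot>\<^bsub>N\<^esub> y) | r x y.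
        r \<in> carrier k \<and> x \<in> carrier M \<and> y \<in> carrier N}"

definition tensor_null ::
    "('k, 'r) ring_scheme \<Rightarrow> ('k, 'a, 'm) module_scheme \<Rightarrow> ('k, 'b, 'n) module_scheme
      \<Rightarrow> ('a \<times> 'b \<Rightarrow>\<^sub>0 int) set"
  where "tensor_null k M N =
     generate (free_Abelian_group (carrier M \<times> carrier N)) (tensor_relations k M N)"

definition tensor_group ::
    "('k, 'r) ring_scheme \<Rightarrow> ('k, 'a, 'm) module_scheme \<Rightarrow> ('k, 'b, 'n) module_scheme
      \<Rightarrow> ('a \<times> 'b \<Rightarrow>\<^sub>0 int) set monoid"
  where "tensor_group k M N = free_Abelian_group (carrier M \<times> carrier N) Mod tensor_null k M N"

definition tensor ::
    "('k, 'r) ring_scheme \<Rightarrow> ('k, 'a, 'm) module_scheme \<Rightarrow> ('k, 'b, 'n) module_scheme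
      \<Rightarrow> 'a \<Rightarrow> 'b \<Rightarrow> ('a \<times> 'b \<Rightarrow>\<^sub>0 int) set"
  where "tensor k M N x y =
     tensor_null k M N #>\<^bsub>free_Abelian_group (carrier M \<times> carrier N)\<^esub> frag_of (x, y)"

text \<open>
  The map induced on a tensor product by a balanced biadditive map \<open>h\<close> into an abelian group \<open>G\<close>
  (in HOL-Algebra a multiplicatively written monoid record): extend \<open>h\<close> to formal sums and evaluate
  on any representative of the coset.
\<close>

definition tensor_lift ::
    "('c, 'g) monoid_scheme \<Rightarrow> ('a \<Rightarrow> 'b \<Rightarrow> 'c) \<Rightarrow> ('a \<times> 'b \<Rightarrow>\<^sub>0 int) set \<Rightarrow> 'c"
  where "tensor_lift G h X = the_elem
     ((\<lambda>c. finprod G (\<lambda>(x, y). h x y [^]\<^bsub>G\<^esub> Poly_Mapping.lookup c (x, y)) (Poly_Mapping.keys c)) ` X)"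

text \<open>
  The fields \<open>mult\<close> and \<open>one\<close> of a module record play no role for a module.
\<close>

definition tensor_product ::
    "('k, 'r) ring_scheme \<Rightarrow> ('k, 'a, 'm) module_scheme \<Rightarrow> ('k, 'b, 'n) module_scheme
      \<Rightarrow> ('k, ('a \<times> 'b \<Rightarrow>\<^sub>0 int) set) module"  (infixr \<open>\<boxtimes>\<index>\<close> 70)
  where "M \<boxtimes>\<^bsub>k\<^esub> N = \<lparr>carrier = carrier (tensor_group k M N),
     mult = (\<lambda>_ _. undefined), one = undefined,
     zero = \<one>\<^bsub>tensor_group k M N\<^esub>, add = mult (tensor_group k M N),
     smult = (\<lambda>r. tensor_lift (tensor_group k M N) (\<lambda>x y. tensor k M N (r \<odot>\<^bsub>M\<^esub> x) y))\<rparr>"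

text \<open>
  In \<open>tensor_map k M N f g\<close>, which is \<open>f \<otimes> g\<close>, the modules \<open>M\<close> and \<open>N\<close> are the targets of \<open>f\<close>
  and \<open>g\<close>; the sources are not needed, since an element of their tensor product is a coset and
  carries its representatives with it.
\<close>

definition tensor_map ::
    "('k, 'r) ring_scheme \<Rightarrow> ('k, 'a, 'm) module_scheme \<Rightarrow> ('k, 'b, 'n) module_scheme
      \<Rightarrow> ('c \<Rightarrow> 'a) \<Rightarrow> ('d \<Rightarrow> 'b) \<Rightarrow> ('c \<times> 'd \<Rightarrow>\<^sub>0 int) set \<Rightarrow> ('a \<times> 'b \<Rightarrow>\<^sub>0 int) set"
  where "tensor_map k M N f g = tensor_lift (tensor_group k M N) (\<lambda>x y. tensor k M N (f x) (g y))"

definition tensor_swap ::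
    "('k, 'r) ring_scheme \<Rightarrow> ('k, 'a, 'm) module_scheme \<Rightarrow> ('k, 'b, 'n) module_scheme
      \<Rightarrow> ('a \<times> 'b \<Rightarrow>\<^sub>0 int) set \<Rightarrow> ('b \<times> 'a \<Rightarrow>\<^sub>0 int) set"
  where "tensor_swap k M N = tensor_lift (tensor_group k N M) (\<lambda>x y. tensor k N M y x)"

text \<open>
  The canonical isomorphisms, which informal tensor calculus leaves implicit:
  \<open>assoc k M N P : (M \<otimes> N) \<otimes> P \<rightarrow> M \<otimes> (N \<otimes> P)\<close>, \<open>lunit k M : k \<otimes> M \<rightarrow> M\<close> and
  \<open>runit k M : M \<otimes> k \<rightarrow> M\<close>, together with their inverses.
\<close>

definition assoc ::
    "('k, 'r) ring_scheme \<Rightarrow> ('k, 'a, 'm) module_scheme \<Rightarrow> ('k, 'b, 'n) module_scheme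
      \<Rightarrow> ('k, 'c, 'p) module_scheme
      \<Rightarrow> (('a \<times> 'b \<Rightarrow>\<^sub>0 int) set \<times> 'c \<Rightarrow>\<^sub>0 int) set \<Rightarrow> ('a \<times> ('b \<times> 'c \<Rightarrow>\<^sub>0 int) set \<Rightarrow>\<^sub>0 int) set"
  where "assoc k M N P = (let G = tensor_group k M (N \<boxtimes>\<^bsub>k\<^esub> P) in
     tensor_lift G (\<lambda>u z. tensor_lift G (\<lambda>x y. tensor k M (N \<boxtimes>\<^bsub>k\<^esub> P) x (tensor k N P y z)) u))"

definition assoc_inv ::
    "('k, 'r) ring_scheme \<Rightarrow> ('k, 'a, 'm) module_scheme \<Rightarrow> ('k, 'b, 'n) module_scheme
      \<Rightarrow> ('k, 'c, 'p) module_scheme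
      \<Rightarrow> ('a \<times> ('b \<times> 'c \<Rightarrow>\<^sub>0 int) set \<Rightarrow>\<^sub>0 int) set \<Rightarrow> (('a \<times> 'b \<Rightarrow>\<^sub>0 int) set \<times> 'c \<Rightarrow>\<^sub>0 int) set"
  where "assoc_inv k M N P = (let G = tensor_group k (M \<boxtimes>\<^bsub>k\<^esub> N) P in
     tensor_lift G (\<lambda>x v. tensor_lift G (\<lambda>y z. tensor k (M \<boxtimes>\<^bsub>k\<^esub> N) P (tensor k M N x y) z) v))"

definition lunit :: "('k, 'r) ring_scheme \<Rightarrow> ('k, 'a, 'm) module_scheme
    \<Rightarrow> ('k \<times> 'a \<Rightarrow>\<^sub>0 int) set \<Rightarrow> 'a"
  where "lunit k M = tensor_lift (add_monoid M) (\<lambda>r x. r \<odot>\<^bsub>M\<^esub> x)"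

definition lunit_inv :: "('k, 'r) ring_scheme \<Rightarrow> ('k, 'a, 'm) module_scheme
    \<Rightarrow> 'a \<Rightarrow> ('k \<times> 'a \<Rightarrow>\<^sub>0 int) set"
  where "lunit_inv k M x = tensor k (scalars k) M \<one>\<^bsub>k\<^esub> x"

definition runit :: "('k, 'r) ring_scheme \<Rightarrow> ('k, 'a, 'm) module_scheme
    \<Rightarrow> ('a \<times> 'k \<Rightarrow>\<^sub>0 int) set \<Rightarrow> 'a"
  where "runit k M = tensor_lift (add_monoid M) (\<lambda>x r. r \<odot>\<^bsub>M\<^esub> x)"

definition runit_inv :: "('k, 'r) ring_scheme \<Rightarrow> ('k, 'a, 'm) module_scheme
    \<Rightarrow> 'a \<Rightarrow> ('a \<times> 'k \<Rightarrow>\<^sub>0 int) set"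
  where "runit_inv k M x = tensor k M (scalars k) x \<one>\<^bsub>k\<^esub>"


section \<open>Commutative Frobenius algebras\<close>

definition mult_map :: "('k, 'a, 'm) module_scheme \<Rightarrow> ('a \<times> 'a \<Rightarrow>\<^sub>0 int) set \<Rightarrow> 'a"
  where "mult_map A = tensor_lift (add_monoid A) (\<lambda>x y. x \<otimes>\<^bsub>A\<^esub> y)"

definition unit_map :: "('k, 'a, 'm) module_scheme \<Rightarrow> 'k \<Rightarrow> 'a"
  where "unit_map A r = r \<odot>\<^bsub>A\<^esub> \<one>\<^bsub>A\<^esub>"

definition pairing_map :: "('k, 'a, 'm) module_scheme \<Rightarrow> ('a \<Rightarrow> 'k) \<Rightarrow> ('a \<times> 'a \<Rightarrow>\<^sub>0 int) set \<Rightarrow> 'k"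
  where "pairing_map A \<epsilon> = \<epsilon> \<circ> mult_map A"

locale commutative_frobenius_algebra = algebra k A
  for k :: "('k, 'r) ring_scheme" (structure) and A :: "('k, 'a, 'm) module_scheme" +
  fixes \<epsilon> :: "'a \<Rightarrow> 'k"
    and \<gamma> :: "'k \<Rightarrow> ('a \<times> 'a \<Rightarrow>\<^sub>0 int) set"
  assumes counit_hom: "\<epsilon> \<in> module_hom k A (scalars k)"
    and copairing_hom: "\<gamma> \<in> module_hom k (scalars k) (A \<boxtimes> A)"
    and nondegenerate:
      "\<And>x. \<lbrakk>x \<in> carrier A; \<forall>y \<in> carrier A. pairing_map A \<epsilon> (tensor k A A x y) = \<zero>\<^bsub>k\<^esub>\<rbrakk>
         \<Longrightarrow> x = \<zero>\<^bsub>A\<^esub>"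
    and snake_left:
      "lunit k A \<circ> tensor_map k (scalars k) A (pairing_map A \<epsilon>) id \<circ> assoc_inv k A A A
         \<circ> tensor_map k A (A \<boxtimes> A) id \<gamma> \<circ> runit_inv k A \<doteq>\<^bsub>A\<^esub> id"
    and snake_right:
      "runit k A \<circ> tensor_map k A (scalars k) id (pairing_map A \<epsilon>) \<circ> assoc k A A A
         \<circ> tensor_map k (A \<boxtimes> A) A \<gamma> id \<circ> lunit_inv k A \<doteq>\<^bsub>A\<^esub> id"

text \<open>
  The comultiplication is \<open>(\<mu> \<otimes> id)(id \<otimes> \<gamma>)\<close>, which in a commutative Frobenius algebra agrees with
  \<open>(id \<otimes> \<mu>)(\<gamma> \<otimes> id)\<close>.
\<close>

definition comult_map ::
    "('k, 'r) ring_scheme \<Rightarrow> ('k, 'a, 'm) module_scheme \<Rightarrow> ('k \<Rightarrow> ('a \<times> 'a \<Rightarrow>\<^sub>0 int) set)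
      \<Rightarrow> 'a \<Rightarrow> ('a \<times> 'a \<Rightarrow>\<^sub>0 int) set"
  where "comult_map k A \<gamma> =
     tensor_map k A A (mult_map A) id \<circ> assoc_inv k A A A
       \<circ> tensor_map k A (A \<boxtimes>\<^bsub>k\<^esub> A) id \<gamma> \<circ> runit_inv k A"

definition handle_element ::
    "('k, 'r) ring_scheme \<Rightarrow> ('k, 'a, 'm) module_scheme \<Rightarrow> ('k \<Rightarrow> ('a \<times> 'a \<Rightarrow>\<^sub>0 int) set) \<Rightarrow> 'a"
  where "handle_element k A \<gamma> = mult_map A (comult_map k A \<gamma> \<one>\<^bsub>A\<^esub>)"


section \<open>Bimodules and bicomodules\<close>

locale bimodule =
  fixes k :: "('k, 'r) ring_scheme" (structure)
    and A :: "('k, 'a, 'm) module_scheme"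
    and M :: "('k, 'b, 'n) module_scheme"
    and la :: "('a \<times> 'b \<Rightarrow>\<^sub>0 int) set \<Rightarrow> 'b"
    and ra :: "('b \<times> 'a \<Rightarrow>\<^sub>0 int) set \<Rightarrow> 'b"
  assumes left_action_hom: "la \<in> module_hom k (A \<boxtimes> M) M"
    and right_action_hom: "ra \<in> module_hom k (M \<boxtimes> A) M"
    and left_action_assoc:
      "la \<circ> tensor_map k A M (mult_map A) id
         \<doteq>\<^bsub>(A \<boxtimes> A) \<boxtimes> M\<^esub> la \<circ> tensor_map k A M id la \<circ> assoc k A A M"
    and right_action_assoc:
      "ra \<circ> tensor_map k M A ra id
         \<doteq>\<^bsub>(M \<boxtimes> A) \<boxtimes> A\<^esub> ra \<circ> tensor_map k M A id (mult_map A) \<circ> assoc k M A A"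
    and left_action_unit: "la \<circ> tensor_map k A M (unit_map A) id \<circ> lunit_inv k M \<doteq>\<^bsub>M\<^esub> id"
    and right_action_unit: "ra \<circ> tensor_map k M A id (unit_map A) \<circ> runit_inv k M \<doteq>\<^bsub>M\<^esub> id"
    and actions_commute:
      "ra \<circ> tensor_map k M A la id
         \<doteq>\<^bsub>(A \<boxtimes> M) \<boxtimes> A\<^esub> la \<circ> tensor_map k A M id ra \<circ> assoc k A M A"

locale bicomodule =
  fixes k :: "('k, 'r) ring_scheme" (structure)
    and A :: "('k, 'a, 'm) module_scheme"
    and \<epsilon> :: "'a \<Rightarrow> 'k"
    and \<Delta> :: "'a \<Rightarrow> ('a \<times> 'a \<Rightarrow>\<^sub>0 int) set"
    and M :: "('k, 'b, 'n) module_scheme"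
    and lc :: "'b \<Rightarrow> ('a \<times> 'b \<Rightarrow>\<^sub>0 int) set"
    and rc :: "'b \<Rightarrow> ('b \<times> 'a \<Rightarrow>\<^sub>0 int) set"
  assumes left_coaction_hom: "lc \<in> module_hom k M (A \<boxtimes> M)"
    and right_coaction_hom: "rc \<in> module_hom k M (M \<boxtimes> A)"
    and left_coaction_coassoc:
      "assoc k A A M \<circ> tensor_map k (A \<boxtimes> A) M \<Delta> id \<circ> lc
         \<doteq>\<^bsub>M\<^esub> tensor_map k A (A \<boxtimes> M) id lc \<circ> lc"
    and right_coaction_coassoc:
      "assoc k M A A \<circ> tensor_map k (M \<boxtimes> A) A rc id \<circ> rc
         \<doteq>\<^bsub>M\<^esub> tensor_map k M (A \<boxtimes> A) id \<Delta> \<circ> rc"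
    and left_coaction_counit: "lunit k M \<circ> tensor_map k (scalars k) M \<epsilon> id \<circ> lc \<doteq>\<^bsub>M\<^esub> id"
    and right_coaction_counit: "runit k M \<circ> tensor_map k M (scalars k) id \<epsilon> \<circ> rc \<doteq>\<^bsub>M\<^esub> id"
    and coactions_commute:
      "assoc k A M A \<circ> tensor_map k (A \<boxtimes> M) A lc id \<circ> rc
         \<doteq>\<^bsub>M\<^esub> tensor_map k A (M \<boxtimes> A) id rc \<circ> lc"

definition bimodule_map ::
    "('k, 'r) ring_scheme \<Rightarrow> ('k, 'a, 'm) module_scheme
      \<Rightarrow> ('k, 'b, 'n) module_scheme \<Rightarrow> (('a \<times> 'b \<Rightarrow>\<^sub>0 int) set \<Rightarrow> 'b) \<Rightarrow> (('b \<times> 'a \<Rightarrow>\<^sub>0 int) set \<Rightarrow> 'b)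
      \<Rightarrow> ('k, 'c, 'p) module_scheme \<Rightarrow> (('a \<times> 'c \<Rightarrow>\<^sub>0 int) set \<Rightarrow> 'c) \<Rightarrow> (('c \<times> 'a \<Rightarrow>\<^sub>0 int) set \<Rightarrow> 'c)
      \<Rightarrow> ('b \<Rightarrow> 'c) \<Rightarrow> bool"
  where "bimodule_map k A M la ra N la' ra' f \<longleftrightarrow>
     f \<in> module_hom k M N \<and>
     f \<circ> la \<doteq>\<^bsub>A \<boxtimes>\<^bsub>k\<^esub> M\<^esub> la' \<circ> tensor_map k A N id f \<and>
     f \<circ> ra \<doteq>\<^bsub>M \<boxtimes>\<^bsub>k\<^esub> A\<^esub> ra' \<circ> tensor_map k N A f id"

definition bicomodule_map ::
    "('k, 'r) ring_scheme \<Rightarrow> ('k, 'a, 'm) module_scheme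
      \<Rightarrow> ('k, 'b, 'n) module_scheme \<Rightarrow> ('b \<Rightarrow> ('a \<times> 'b \<Rightarrow>\<^sub>0 int) set) \<Rightarrow> ('b \<Rightarrow> ('b \<times> 'a \<Rightarrow>\<^sub>0 int) set)
      \<Rightarrow> ('k, 'c, 'p) module_scheme \<Rightarrow> ('c \<Rightarrow> ('a \<times> 'c \<Rightarrow>\<^sub>0 int) set) \<Rightarrow> ('c \<Rightarrow> ('c \<times> 'a \<Rightarrow>\<^sub>0 int) set)
      \<Rightarrow> ('b \<Rightarrow> 'c) \<Rightarrow> bool"
  where "bicomodule_map k A M lc rc N lc' rc' f \<longleftrightarrow>
     f \<in> module_hom k M N \<and>
     lc' \<circ> f \<doteq>\<^bsub>M\<^esub> tensor_map k A N id f \<circ> lc \<and>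
     rc' \<circ> f \<doteq>\<^bsub>M\<^esub> tensor_map k N A f id \<circ> rc"

text \<open>
  The bimodule and bicomodule structure on \<open>M \<otimes> M\<close>: the left (co)action is the one of the left
  factor, the right (co)action the one of the right factor.
\<close>

definition left_action2 ::
    "('k, 'r) ring_scheme \<Rightarrow> ('k, 'a, 'm) module_scheme \<Rightarrow> ('k, 'b, 'n) module_scheme
      \<Rightarrow> (('a \<times> 'b \<Rightarrow>\<^sub>0 int) set \<Rightarrow> 'b)
      \<Rightarrow> ('a \<times> ('b \<times> 'b \<Rightarrow>\<^sub>0 int) set \<Rightarrow>\<^sub>0 int) set \<Rightarrow> ('b \<times> 'b \<Rightarrow>\<^sub>0 int) set"
  where "left_action2 k A M la = tensor_map k M M la id \<circ> assoc_inv k A M M"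

definition right_action2 ::
    "('k, 'r) ring_scheme \<Rightarrow> ('k, 'a, 'm) module_scheme \<Rightarrow> ('k, 'b, 'n) module_scheme
      \<Rightarrow> (('b \<times> 'a \<Rightarrow>\<^sub>0 int) set \<Rightarrow> 'b)
      \<Rightarrow> (('b \<times> 'b \<Rightarrow>\<^sub>0 int) set \<times> 'a \<Rightarrow>\<^sub>0 int) set \<Rightarrow> ('b \<times> 'b \<Rightarrow>\<^sub>0 int) set"
  where "right_action2 k A M ra = tensor_map k M M id ra \<circ> assoc k M M A"

definition left_coaction2 ::
    "('k, 'r) ring_scheme \<Rightarrow> ('k, 'a, 'm) module_scheme \<Rightarrow> ('k, 'b, 'n) module_scheme
      \<Rightarrow> ('b \<Rightarrow> ('a \<times> 'b \<Rightarrow>\<^sub>0 int) set)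
      \<Rightarrow> ('b \<times> 'b \<Rightarrow>\<^sub>0 int) set \<Rightarrow> ('a \<times> ('b \<times> 'b \<Rightarrow>\<^sub>0 int) set \<Rightarrow>\<^sub>0 int) set"
  where "left_coaction2 k A M lc = assoc k A M M \<circ> tensor_map k (A \<boxtimes>\<^bsub>k\<^esub> M) M lc id"

definition right_coaction2 ::
    "('k, 'r) ring_scheme \<Rightarrow> ('k, 'a, 'm) module_scheme \<Rightarrow> ('k, 'b, 'n) module_scheme
      \<Rightarrow> ('b \<Rightarrow> ('b \<times> 'a \<Rightarrow>\<^sub>0 int) set)
      \<Rightarrow> ('b \<times> 'b \<Rightarrow>\<^sub>0 int) set \<Rightarrow> (('b \<times> 'b \<Rightarrow>\<^sub>0 int) set \<times> 'a \<Rightarrow>\<^sub>0 int) set"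
  where "right_coaction2 k A M rc = assoc_inv k M M A \<circ> tensor_map k M (M \<boxtimes>\<^bsub>k\<^esub> A) id rc"


section \<open>Commutative Frobenius pairs\<close>

text \<open>
  Naming of the structure maps: the letters after \<open>\<mu>\<close> are the two source factors followed by the
  target, the letters after \<open>\<Delta>\<close> are the source followed by the two target factors, and the letters
  after \<open>\<nu>\<close> are source and target; for instance \<open>\<mu>AEE : A \<otimes> E \<rightarrow> E\<close>, \<open>\<Delta>EEA : E \<rightarrow> E \<otimes> A\<close>.
\<close>

locale commutative_frobenius_pair =
  commutative_frobenius_algebra k A \<epsilon> \<gamma> +
  E: module k E +
  bimodule k A E \<mu>AEE \<mu>EAE +
  bicomodule k A \<epsilon> "comult_map k A \<gamma>" E \<Delta>EAE \<Delta>EEA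
  for k :: "('k, 'r) ring_scheme" (structure)
    and A :: "('k, 'a, 'm) module_scheme"
    and \<epsilon> :: "'a \<Rightarrow> 'k"
    and \<gamma> :: "'k \<Rightarrow> ('a \<times> 'a \<Rightarrow>\<^sub>0 int) set"
    and E :: "('k, 'e, 'n) module_scheme"
    and \<mu>AEE :: "('a \<times> 'e \<Rightarrow>\<^sub>0 int) set \<Rightarrow> 'e"
    and \<mu>EAE :: "('e \<times> 'a \<Rightarrow>\<^sub>0 int) set \<Rightarrow> 'e"
    and \<Delta>EAE :: "'e \<Rightarrow> ('a \<times> 'e \<Rightarrow>\<^sub>0 int) set"
    and \<Delta>EEA :: "'e \<Rightarrow> ('e \<times> 'a \<Rightarrow>\<^sub>0 int) set" +
  fixes \<mu>EEE :: "('e \<times> 'e \<Rightarrow>\<^sub>0 int) set \<Rightarrow> 'e"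
    and \<Delta>EEE :: "'e \<Rightarrow> ('e \<times> 'e \<Rightarrow>\<^sub>0 int) set"
    and \<mu>EEA :: "('e \<times> 'e \<Rightarrow>\<^sub>0 int) set \<Rightarrow> 'a"
    and \<Delta>AEE :: "'a \<Rightarrow> ('e \<times> 'e \<Rightarrow>\<^sub>0 int) set"
  assumes actions_swap: "\<mu>EAE \<circ> tensor_swap k A E \<doteq>\<^bsub>A \<boxtimes> E\<^esub> \<mu>AEE"
    and coactions_swap: "tensor_swap k A E \<circ> \<Delta>EAE \<doteq>\<^bsub>E\<^esub> \<Delta>EEA"
    and action_from_coaction:
      "lunit k E \<circ> tensor_map k (scalars k) E (pairing_map A \<epsilon>) id \<circ> assoc_inv k A A E
         \<circ> tensor_map k A (A \<boxtimes> E) id \<Delta>EAE \<doteq>\<^bsub>A \<boxtimes> E\<^esub> \<mu>AEE"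
    and coaction_from_action:
      "tensor_map k A E id \<mu>AEE \<circ> assoc k A A E \<circ> tensor_map k (A \<boxtimes> A) E \<gamma> id \<circ> lunit_inv k E
         \<doteq>\<^bsub>E\<^esub> \<Delta>EAE"
    and muEEE_assoc:
      "\<mu>EEE \<circ> tensor_map k E E \<mu>EEE id
         \<doteq>\<^bsub>(E \<boxtimes> E) \<boxtimes> E\<^esub> \<mu>EEE \<circ> tensor_map k E E id \<mu>EEE \<circ> assoc k E E E"
    and muEEE_comm: "\<mu>EEE \<circ> tensor_swap k E E \<doteq>\<^bsub>E \<boxtimes> E\<^esub> \<mu>EEE"
    and muEEE_bimodule_map:
      "bimodule_map k A (E \<boxtimes> E) (left_action2 k A E \<mu>AEE) (right_action2 k A E \<mu>EAE) E \<mu>AEE \<mu>EAE \<mu>EEE"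
    and muEEE_bicomodule_map:
      "bicomodule_map k A (E \<boxtimes> E) (left_coaction2 k A E \<Delta>EAE) (right_coaction2 k A E \<Delta>EEA) E \<Delta>EAE \<Delta>EEA \<mu>EEE"
    and DeltaEEE_coassoc:
      "assoc k E E E \<circ> tensor_map k (E \<boxtimes> E) E \<Delta>EEE id \<circ> \<Delta>EEE
         \<doteq>\<^bsub>E\<^esub> tensor_map k E (E \<boxtimes> E) id \<Delta>EEE \<circ> \<Delta>EEE"
    and DeltaEEE_cocomm: "tensor_swap k E E \<circ> \<Delta>EEE \<doteq>\<^bsub>E\<^esub> \<Delta>EEE"
    and DeltaEEE_bimodule_map:
      "bimodule_map k A E \<mu>AEE \<mu>EAE (E \<boxtimes> E) (left_action2 k A E \<mu>AEE) (right_action2 k A E \<mu>EAE) \<Delta>EEE"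
    and DeltaEEE_bicomodule_map:
      "bicomodule_map k A E \<Delta>EAE \<Delta>EEA (E \<boxtimes> E) (left_coaction2 k A E \<Delta>EAE) (right_coaction2 k A E \<Delta>EEA) \<Delta>EEE"
    and frobenius_EEE_left:
      "tensor_map k E E id \<mu>EEE \<circ> assoc k E E E \<circ> tensor_map k (E \<boxtimes> E) E \<Delta>EEE id
         \<doteq>\<^bsub>E \<boxtimes> E\<^esub> \<Delta>EEE \<circ> \<mu>EEE"
    and frobenius_EEE_right:
      "\<Delta>EEE \<circ> \<mu>EEE
         \<doteq>\<^bsub>E \<boxtimes> E\<^esub> tensor_map k E E \<mu>EEE id \<circ> assoc_inv k E E E \<circ> tensor_map k E (E \<boxtimes> E) id \<Delta>EEE"
    and muEEA_comm: "\<mu>EEA \<circ> tensor_swap k E E \<doteq>\<^bsub>E \<boxtimes> E\<^esub> \<mu>EEA"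
    and muEEA_bimodule_map:
      "bimodule_map k A (E \<boxtimes> E) (left_action2 k A E \<mu>AEE) (right_action2 k A E \<mu>EAE)
         A (mult_map A) (mult_map A) \<mu>EEA"
    and muEEA_bicomodule_map:
      "bicomodule_map k A (E \<boxtimes> E) (left_coaction2 k A E \<Delta>EAE) (right_coaction2 k A E \<Delta>EEA)
         A (comult_map k A \<gamma>) (comult_map k A \<gamma>) \<mu>EEA"
    and DeltaAEE_cocomm: "tensor_swap k E E \<circ> \<Delta>AEE \<doteq>\<^bsub>A\<^esub> \<Delta>AEE"
    and DeltaAEE_bimodule_map:
      "bimodule_map k A A (mult_map A) (mult_map A)
         (E \<boxtimes> E) (left_action2 k A E \<mu>AEE) (right_action2 k A E \<mu>EAE) \<Delta>AEE"
    and DeltaAEE_bicomodule_map: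
      "bicomodule_map k A A (comult_map k A \<gamma>) (comult_map k A \<gamma>)
         (E \<boxtimes> E) (left_coaction2 k A E \<Delta>EAE) (right_coaction2 k A E \<Delta>EEA) \<Delta>AEE"
    and muEEA_assoc:
      "\<mu>AEE \<circ> tensor_map k A E \<mu>EEA id
         \<doteq>\<^bsub>(E \<boxtimes> E) \<boxtimes> E\<^esub> \<mu>EAE \<circ> tensor_map k E A id \<mu>EEA \<circ> assoc k E E E"
    and muEEA_muEEE_assoc:
      "\<mu>EEA \<circ> tensor_map k E E \<mu>EEE id
         \<doteq>\<^bsub>(E \<boxtimes> E) \<boxtimes> E\<^esub> \<mu>EEA \<circ> tensor_map k E E id \<mu>EEE \<circ> assoc k E E E"
    and DeltaAEE_coassoc:
      "assoc k E E E \<circ> tensor_map k (E \<boxtimes> E) E \<Delta>AEE id \<circ> \<Delta>EAE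
         \<doteq>\<^bsub>E\<^esub> tensor_map k E (E \<boxtimes> E) id \<Delta>AEE \<circ> \<Delta>EEA"
    and DeltaAEE_DeltaEEE_coassoc:
      "assoc k E E E \<circ> tensor_map k (E \<boxtimes> E) E \<Delta>EEE id \<circ> \<Delta>AEE
         \<doteq>\<^bsub>A\<^esub> tensor_map k E (E \<boxtimes> E) id \<Delta>EEE \<circ> \<Delta>AEE"
    and DeltaEAE_muAEE:
      "\<Delta>EAE \<circ> \<mu>AEE \<doteq>\<^bsub>A \<boxtimes> E\<^esub>
         tensor_map k A E id \<mu>AEE \<circ> assoc k A A E \<circ> tensor_map k (A \<boxtimes> A) E (comult_map k A \<gamma>) id"
      "\<Delta>EAE \<circ> \<mu>AEE \<doteq>\<^bsub>A \<boxtimes> E\<^esub>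
         tensor_map k A E (mult_map A) id \<circ> assoc_inv k A A E \<circ> tensor_map k A (A \<boxtimes> E) id \<Delta>EAE"
    and DeltaEEA_muEAE:
      "\<Delta>EEA \<circ> \<mu>EAE \<doteq>\<^bsub>E \<boxtimes> A\<^esub>
         tensor_map k E A \<mu>EAE id \<circ> assoc_inv k E A A \<circ> tensor_map k E (A \<boxtimes> A) id (comult_map k A \<gamma>)"
      "\<Delta>EEA \<circ> \<mu>EAE \<doteq>\<^bsub>E \<boxtimes> A\<^esub>
         tensor_map k E A id (mult_map A) \<circ> assoc k E A A \<circ> tensor_map k (E \<boxtimes> A) A \<Delta>EEA id"
    and DeltaEAE_muEEE:
      "\<Delta>EAE \<circ> \<mu>EEE \<doteq>\<^bsub>E \<boxtimes> E\<^esub>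
         tensor_map k A E id \<mu>EEE \<circ> assoc k A E E \<circ> tensor_map k (A \<boxtimes> E) E \<Delta>EAE id"
    and DeltaEEA_muEEE:
      "\<Delta>EEA \<circ> \<mu>EEE \<doteq>\<^bsub>E \<boxtimes> E\<^esub>
         tensor_map k E A \<mu>EEE id \<circ> assoc_inv k E E A \<circ> tensor_map k E (E \<boxtimes> A) id \<Delta>EEA"
    and DeltaEEE_muAEE:
      "\<Delta>EEE \<circ> \<mu>AEE \<doteq>\<^bsub>A \<boxtimes> E\<^esub>
         tensor_map k E E \<mu>AEE id \<circ> assoc_inv k A E E \<circ> tensor_map k A (E \<boxtimes> E) id \<Delta>EEE"
    and DeltaEEE_muEAE:
      "\<Delta>EEE \<circ> \<mu>EAE \<doteq>\<^bsub>E \<boxtimes> A\<^esub>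
         tensor_map k E E id \<mu>EAE \<circ> assoc k E E A \<circ> tensor_map k (E \<boxtimes> E) A \<Delta>EEE id"
    \<comment> \<open>the two right-hand sides of \<open>DeltaAEE_muEEA\<close> are mirror images of each other\<close>
    and DeltaAEE_muEEA:
      "\<Delta>AEE \<circ> \<mu>EEA \<doteq>\<^bsub>E \<boxtimes> E\<^esub>
         tensor_map k E E id \<mu>AEE \<circ> assoc k E A E \<circ> tensor_map k (E \<boxtimes> A) E \<Delta>EEA id"
      "\<Delta>AEE \<circ> \<mu>EEA \<doteq>\<^bsub>E \<boxtimes> E\<^esub>
         tensor_map k E E \<mu>EAE id \<circ> assoc_inv k E A E \<circ> tensor_map k E (A \<boxtimes> E) id \<Delta>EAE"
    and consistency_mult:
      "\<mu>AEE \<circ> tensor_map k A E \<mu>EEA id \<doteq>\<^bsub>(E \<boxtimes> E) \<boxtimes> E\<^esub> \<mu>EEE \<circ> tensor_map k E E \<mu>EEE id"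
    and consistency_EE: "\<Delta>AEE \<circ> \<mu>EEA \<doteq>\<^bsub>E \<boxtimes> E\<^esub> \<Delta>EEE \<circ> \<mu>EEE"
    and consistency_E: "\<mu>AEE \<circ> \<Delta>EAE \<doteq>\<^bsub>E\<^esub> \<mu>EEE \<circ> \<Delta>EEE"


section \<open>Moebius maps\<close>

locale commutative_frobenius_pair_moebius =
  commutative_frobenius_pair k A \<epsilon> \<gamma> E \<mu>AEE \<mu>EAE \<Delta>EAE \<Delta>EEA \<mu>EEE \<Delta>EEE \<mu>EEA \<Delta>AEE
  for k :: "('k, 'r) ring_scheme" (structure)
    and A :: "('k, 'a, 'm) module_scheme"
    and \<epsilon> :: "'a \<Rightarrow> 'k"
    and \<gamma> :: "'k \<Rightarrow> ('a \<times> 'a \<Rightarrow>\<^sub>0 int) set"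
    and E :: "('k, 'e, 'n) module_scheme"
    and \<mu>AEE :: "('a \<times> 'e \<Rightarrow>\<^sub>0 int) set \<Rightarrow> 'e"
    and \<mu>EAE :: "('e \<times> 'a \<Rightarrow>\<^sub>0 int) set \<Rightarrow> 'e"
    and \<Delta>EAE :: "'e \<Rightarrow> ('a \<times> 'e \<Rightarrow>\<^sub>0 int) set"
    and \<Delta>EEA :: "'e \<Rightarrow> ('e \<times> 'a \<Rightarrow>\<^sub>0 int) set"
    and \<mu>EEE :: "('e \<times> 'e \<Rightarrow>\<^sub>0 int) set \<Rightarrow> 'e"
    and \<Delta>EEE :: "'e \<Rightarrow> ('e \<times> 'e \<Rightarrow>\<^sub>0 int) set"
    and \<mu>EEA :: "('e \<times> 'e \<Rightarrow>\<^sub>0 int) set \<Rightarrow> 'a"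
    and \<Delta>AEE :: "'a \<Rightarrow> ('e \<times> 'e \<Rightarrow>\<^sub>0 int) set" +
  fixes \<nu>AE :: "'a \<Rightarrow> 'e"
    and \<nu>EA :: "'e \<Rightarrow> 'a"
    and \<nu>EE :: "'e \<Rightarrow> 'e"
  assumes nuAE_hom: "\<nu>AE \<in> module_hom k A E"
    and nuEA_hom: "\<nu>EA \<in> module_hom k E A"
    and nuEE_hom: "\<nu>EE \<in> module_hom k E E"
    and nuEA_nuAE:
      "\<nu>EA \<circ> \<nu>AE \<doteq>\<^bsub>A\<^esub> mult_map A \<circ> comult_map k A \<gamma>"
      "mult_map A \<circ> comult_map k A \<gamma> \<doteq>\<^bsub>A\<^esub> \<mu>EEA \<circ> \<Delta>AEE"
    and nuEE_nuEE: "\<nu>EE \<circ> \<nu>EE \<doteq>\<^bsub>E\<^esub> \<mu>EEE \<circ> \<Delta>EEE"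
    and muEAE_nuAE: "\<mu>EAE \<circ> tensor_map k E A \<nu>AE id \<doteq>\<^bsub>A \<boxtimes> A\<^esub> \<nu>AE \<circ> mult_map A"
    and nuEA_DeltaEEA:
      "tensor_map k A A \<nu>EA id \<circ> \<Delta>EEA \<doteq>\<^bsub>E\<^esub> comult_map k A \<gamma> \<circ> \<nu>EA"
    and muA_nuEA: "mult_map A \<circ> tensor_map k A A \<nu>EA id \<doteq>\<^bsub>E \<boxtimes> A\<^esub> \<nu>EA \<circ> \<mu>EAE"
    and nuAE_DeltaA:
      "tensor_map k E A \<nu>AE id \<circ> comult_map k A \<gamma> \<doteq>\<^bsub>A\<^esub> \<Delta>EEA \<circ> \<nu>AE"
    and muEEA_nuAE:
      "\<mu>EEA \<circ> tensor_map k E E \<nu>AE id \<doteq>\<^bsub>A \<boxtimes> E\<^esub> mult_map A \<circ> tensor_map k A A id \<nu>EA"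
    and nuEA_DeltaAEE:
      "tensor_map k A E \<nu>EA id \<circ> \<Delta>AEE \<doteq>\<^bsub>A\<^esub> tensor_map k A E id \<nu>AE \<circ> comult_map k A \<gamma>"
    and muEEE_nuAE: "\<mu>EEE \<circ> tensor_map k E E \<nu>AE id \<doteq>\<^bsub>A \<boxtimes> E\<^esub> \<nu>EE \<circ> \<mu>AEE"
    and nuEA_DeltaEEE: "tensor_map k A E \<nu>EA id \<circ> \<Delta>EEE \<doteq>\<^bsub>E\<^esub> \<Delta>EAE \<circ> \<nu>EE"
    and nuEA_muEEE: "\<nu>EA \<circ> \<mu>EEE \<doteq>\<^bsub>E \<boxtimes> E\<^esub> \<mu>EEA \<circ> tensor_map k E E \<nu>EE id"
    and DeltaEEE_nuAE: "\<Delta>EEE \<circ> \<nu>AE \<doteq>\<^bsub>A\<^esub> tensor_map k E E \<nu>EE id \<circ> \<Delta>AEE"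
    and muAEE_nuEE: "\<mu>AEE \<circ> tensor_map k A E id \<nu>EE \<doteq>\<^bsub>A \<boxtimes> E\<^esub> \<nu>EE \<circ> \<mu>AEE"
    and nuEE_DeltaEAE: "tensor_map k A E id \<nu>EE \<circ> \<Delta>EAE \<doteq>\<^bsub>E\<^esub> \<Delta>EAE \<circ> \<nu>EE"
    and muEEE_nuEE: "\<mu>EEE \<circ> tensor_map k E E \<nu>EE id \<doteq>\<^bsub>E \<boxtimes> E\<^esub> \<nu>EE \<circ> \<mu>EEE"
    and nuEE_DeltaEEE: "tensor_map k E E \<nu>EE id \<circ> \<Delta>EEE \<doteq>\<^bsub>E\<^esub> \<Delta>EEE \<circ> \<nu>EE"

end

theory Submission
  imports Defs
begin

text \<open>
  The pair is \<open>(A, A)\<close>: take \<open>E = A\<close>, let every action and every multiplication be \<open>\<mu>\<close> and every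
  coaction and every comultiplication be \<open>\<Delta>\<close>, and let all three Moebius maps be \<open>\<nu> x = \<xi> x\<close>.
  With these choices each axiom of a commutative Frobenius pair turns into one of the standard laws of
  the Frobenius algebra \<open>A\<close> (commutativity and associativity of \<open>\<mu>\<close>, their duals for \<open>\<Delta>\<close>, the
  Frobenius relation, and the two formulas that express \<open>\<mu>\<close> and \<open>\<Delta>\<close> through each other by means
  of \<open>\<beta>\<close> and \<open>\<gamma>\<close>), or becomes a trivial identity. Multiplication by an element of \<open>A\<close> passes
  through \<open>\<mu>\<close> and \<open>\<Delta>\<close> on either side, so that only \<open>\<nu>\<nu> = \<mu>\<Delta>\<close> says anything about \<open>\<xi>\<close>; as
  \<open>\<mu>\<Delta>\<close> is multiplication by the handle element, this is \<open>\<xi>\<xi> = \<phi>\<close>.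

  The laws for \<open>\<Delta>\<close> come from the snake equations. Write \<open>\<Gamma> = \<gamma> 1\<close> for the copairing
  element and \<open>x \<rhd> t\<close>, \<open>t \<lhd> x\<close> for multiplication by \<open>x\<close> in the first and in the second factor of
  \<open>t \<in> A \<otimes> A\<close>; by definition \<open>\<Delta> x = x \<rhd> \<Gamma>\<close>. Contracting the two inner factors of
  \<open>t \<otimes> s\<close> with the pairing gives an element of \<open>A \<otimes> A\<close> that can be read as a map applied to
  \<open>s\<close> or as a map applied to \<open>t\<close> (\<open>pairing_slide\<close>). For \<open>t = \<Gamma>\<close> and \<open>s = x \<rhd> \<Gamma>\<close> the snake
  equations evaluate both readings and give \<open>\<Gamma> \<lhd> x = x \<rhd> \<Gamma>\<close> (\<open>comult_ract\<close>); replacing \<open>t\<close>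
  by the transposed copairing and \<open>x\<close> by \<open>1\<close>, they show that \<open>\<Gamma>\<close> is symmetric
  (\<open>copairing_symmetric\<close>). The remaining laws follow. Coassociativity uses the
  same trick with multiplication in place of the pairing (\<open>action_slide\<close>).

  Elements of \<open>A \<otimes> A\<close> such as \<open>\<Gamma>\<close> are never expanded into sums of pure tensors. An equation
  between linear maps is reduced to pure tensors, where it is a computation, by the universal
  property of the tensor product; this is why a map is written as a composite of canonical maps, for
  which linearity is syntactically evident.
\<close>

section \<open>The universal property of the tensor product\<close>

definition balanced_map ::
    "('k, 'r) ring_scheme \<Rightarrow> ('k, 'a, 'm) module_scheme \<Rightarrow> ('k, 'b, 'n) module_scheme
      \<Rightarrow> ('c, 'g) monoid_scheme \<Rightarrow> ('a \<Rightarrow> 'b \<Rightarrow> 'c) \<Rightarrow> bool"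
  where "balanced_map k M N G h \<longleftrightarrow>
     (\<forall>x \<in> carrier M. \<forall>y \<in> carrier N. h x y \<in> carrier G) \<and>
     (\<forall>x \<in> carrier M. \<forall>x' \<in> carrier M. \<forall>y \<in> carrier N.
        h (x \<oplus>\<^bsub>M\<^esub> x') y = h x y \<otimes>\<^bsub>G\<^esub> h x' y) \<and>
     (\<forall>x \<in> carrier M. \<forall>y \<in> carrier N. \<forall>y' \<in> carrier N.
        h x (y \<oplus>\<^bsub>N\<^esub> y') = h x y \<otimes>\<^bsub>G\<^esub> h x y') \<and>
     (\<forall>r \<in> carrier k. \<forall>x \<in> carrier M. \<forall>y \<in> carrier N. h (r \<odot>\<^bsub>M\<^esub> x) y = h x (r \<odot>\<^bsub>N\<^esub> y))"

text \<open>
  The extension of \<open>f\<close> to formal sums, with the group \<open>G\<close> written multiplicatively: the value that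
  \<open>tensor_lift\<close> computes on a representative.
\<close>

definition formal_eval :: "('c, 'g) monoid_scheme \<Rightarrow> ('z \<Rightarrow> 'c) \<Rightarrow> ('z \<Rightarrow>\<^sub>0 int) \<Rightarrow> 'c"
  where "formal_eval G f c =
     finprod G (\<lambda>z. f z [^]\<^bsub>G\<^esub> Poly_Mapping.lookup c z) (Poly_Mapping.keys c)"

text \<open>
  Replacing the support of \<open>c\<close> by an index set that does not depend on \<open>c\<close> makes additivity in \<open>c\<close>
  a matter of distributing a product.
\<close>

lemma (in comm_group) formal_eval_eq_gfinprod:
  assumes f: "f \<in> S \<rightarrow> carrier G" and c: "Poly_Mapping.keys c \<subseteq> S"
  shows "formal_eval G f c = gfinprod G (\<lambda>z. f z [^] Poly_Mapping.lookup c z) S"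
proof -
  let ?g = "\<lambda>z. f z [^] Poly_Mapping.lookup c z"
  have g: "?g \<in> S \<rightarrow> carrier G"
    using f by auto
  have "formal_eval G f c = gfinprod G ?g (Poly_Mapping.keys c)"
    unfolding formal_eval_def
    by (rule gfinprod_eq_finprod [symmetric]) (use g c in auto)
  also have "\<dots> = gfinprod G ?g S"
    by (rule gfinprod_mono_neutral_cong_left [OF c _ _ g]) (auto simp: in_keys_iff)
  finally show ?thesis .
qed

lemma (in comm_group) formal_eval_hom:
  assumes f: "f \<in> S \<rightarrow> carrier G"
  shows "formal_eval G f \<in> hom (free_Abelian_group S) G"
proof (rule homI)
  fix c d
  assume c: "c \<in> carrier (free_Abelian_group S)" and d: "d \<in> carrier (free_Abelian_group S)"
  have fin: "finite {z \<in> S. f z [^] Poly_Mapping.lookup u z \<noteq> \<one>}" for u :: "_ \<Rightarrow>\<^sub>0 int"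
    by (rule finite_subset [OF _ finite_keys [of u]]) (auto simp: in_keys_iff)
  have cd: "Poly_Mapping.keys (c + d) \<subseteq> S"
    using c d keys_add [of c d] by auto
  show "formal_eval G f (c \<otimes>\<^bsub>free_Abelian_group S\<^esub> d) = formal_eval G f c \<otimes> formal_eval G f d"
    using c d cd f
    by (simp add: formal_eval_eq_gfinprod [OF f] gfinprod_distrib [symmetric] fin Pi_iff
        lookup_add int_pow_mult cong: gfinprod_cong)
qed (use f in \<open>auto simp: formal_eval_eq_gfinprod [OF f] Pi_iff intro!: gfinprod_closed\<close>)

lemma (in comm_group) formal_eval_frag_of:
  assumes "f z \<in> carrier G"
  shows "formal_eval G f (frag_of z) = f z"
  using assms by (simp add: formal_eval_def finprod_singleton)

locale module_pair = M: module k M + N: module k N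
  for k :: "('k, 'r) ring_scheme" (structure)
    and M :: "('k, 'a, 'm) module_scheme"
    and N :: "('k, 'b, 'n) module_scheme"
begin

abbreviation F where "F \<equiv> free_Abelian_group (carrier M \<times> carrier N)"
abbreviation coset where "coset c \<equiv> tensor_null k M N #>\<^bsub>F\<^esub> c"

sublocale F: comm_group F
  by (rule abelian_free_Abelian_group)

lemma tensor_relations_subset: "tensor_relations k M N \<subseteq> carrier F"
  unfolding tensor_relations_def
  by (auto dest!: subsetD [OF keys_diff] split: if_splits)

lemma tensor_null_subgroup: "subgroup (tensor_null k M N) F"
  unfolding tensor_null_def by (rule F.generate_is_subgroup [OF tensor_relations_subset])

sublocale Q: normal "tensor_null k M N" F
  by (rule F.subgroup_imp_normal [OF tensor_null_subgroup])

sublocale TG: comm_group "tensor_group k M N"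
  unfolding tensor_group_def by (rule F.abelian_FactGroup [OF tensor_null_subgroup])

lemma coset_closed: "c \<in> carrier F \<Longrightarrow> coset c \<in> carrier (tensor_group k M N)"
  by (auto simp: tensor_group_def carrier_FactGroup)

lemma coset_add:
  "c \<in> carrier F \<Longrightarrow> d \<in> carrier F \<Longrightarrow>
     coset c \<otimes>\<^bsub>tensor_group k M N\<^esub> coset d = coset (c + d)"
  by (simp add: tensor_group_def Q.rcos_sum del: carrier_free_Abelian_group_iff)

lemma coset_zero: "coset 0 = \<one>\<^bsub>tensor_group k M N\<^esub>"
  using F.coset_mult_one [OF Q.subset] by (simp add: tensor_group_def)

lemma coset_eqI:
  assumes "c \<in> carrier F" "d \<in> carrier F" "c - d \<in> tensor_null k M N"
  shows "coset c = coset d"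
proof -
  have "c = (c - d) + d" by simp
  then have "c \<in> coset d"
    using assms(3) unfolding r_coset_def mult_free_Abelian_group by blast
  then show ?thesis
    using F.repr_independence [OF _ assms(2) tensor_null_subgroup] by simp
qed

lemma tensor_closed [simp, intro]:
  "x \<in> carrier M \<Longrightarrow> y \<in> carrier N \<Longrightarrow> tensor k M N x y \<in> carrier (tensor_group k M N)"
  unfolding tensor_def by (rule coset_closed) simp

lemma relation_null: "c \<in> tensor_relations k M N \<Longrightarrow> c \<in> tensor_null k M N"
  unfolding tensor_null_def by (rule generate.incl)

lemma formal_sum_closed: "c \<in> carrier F \<Longrightarrow> d \<in> carrier F \<Longrightarrow> c + d \<in> carrier F"
  using F.m_closed by simp

lemma tensor_add_left:
  assumes "x \<in> carrier M" "x' \<in> carrier M" "y \<in> carrier N"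
  shows "tensor k M N (x \<oplus>\<^bsub>M\<^esub> x') y =
     tensor k M N x y \<otimes>\<^bsub>tensor_group k M N\<^esub> tensor k M N x' y"
proof -
  have "frag_of (x \<oplus>\<^bsub>M\<^esub> x', y) - (frag_of (x, y) + frag_of (x', y)) \<in> tensor_null k M N"
    by (rule relation_null) (use assms in \<open>auto simp: tensor_relations_def diff_diff_eq\<close>)
  moreover have "frag_of (x, y) + frag_of (x', y) \<in> carrier F"
    by (rule formal_sum_closed) (use assms in auto)
  ultimately have "coset (frag_of (x \<oplus>\<^bsub>M\<^esub> x', y)) = coset (frag_of (x, y) + frag_of (x', y))"
    using assms by (intro coset_eqI) auto
  then show ?thesis
    unfolding tensor_def using assms by (simp add: coset_add)
qed

lemma tensor_add_right:
  assumes "x \<in> carrier M" "y \<in> carrier N" "y' \<in> carrier N"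
  shows "tensor k M N x (y \<oplus>\<^bsub>N\<^esub> y') =
     tensor k M N x y \<otimes>\<^bsub>tensor_group k M N\<^esub> tensor k M N x y'"
proof -
  have "frag_of (x, y \<oplus>\<^bsub>N\<^esub> y') - (frag_of (x, y) + frag_of (x, y')) \<in> tensor_null k M N"
    by (rule relation_null) (use assms in \<open>auto simp: tensor_relations_def diff_diff_eq\<close>)
  moreover have "frag_of (x, y) + frag_of (x, y') \<in> carrier F"
    by (rule formal_sum_closed) (use assms in auto)
  ultimately have "coset (frag_of (x, y \<oplus>\<^bsub>N\<^esub> y')) = coset (frag_of (x, y) + frag_of (x, y'))"
    using assms by (intro coset_eqI) auto
  then show ?thesis
    unfolding tensor_def using assms by (simp add: coset_add)
qed

lemma tensor_balanced:
  assumes "r \<in> carrier k" "x \<in> carrier M" "y \<in> carrier N"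
  shows "tensor k M N (r \<odot>\<^bsub>M\<^esub> x) y = tensor k M N x (r \<odot>\<^bsub>N\<^esub> y)"
  unfolding tensor_def
  by (intro coset_eqI relation_null) (use assms in \<open>auto simp: tensor_relations_def\<close>)

text \<open>
  Negation is absorbed by the first factor, so that sums of pure tensors already exhaust the tensor
  product and no differences are needed in the induction rule below.
\<close>

lemma tensor_uminus_left:
  assumes "x \<in> carrier M" "y \<in> carrier N"
  shows "tensor k M N (\<ominus>\<^bsub>M\<^esub> x) y = coset (- frag_of (x, y))"
proof -
  have cl: "- frag_of (x, y) \<in> carrier F" "frag_of (x, y) \<in> carrier F"
    using assms by auto
  have zero: "tensor k M N \<zero>\<^bsub>M\<^esub> y = \<one>\<^bsub>tensor_group k M N\<^esub>"
    using tensor_add_left [of "\<zero>\<^bsub>M\<^esub>" "\<zero>\<^bsub>M\<^esub>" y] assms TG.l_cancel_one' by simp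
  have "tensor k M N x y \<otimes>\<^bsub>tensor_group k M N\<^esub> tensor k M N (\<ominus>\<^bsub>M\<^esub> x) y
      = tensor k M N x y \<otimes>\<^bsub>tensor_group k M N\<^esub> coset (- frag_of (x, y))"
    using assms cl
    by (simp add: tensor_add_left [symmetric] M.M.r_neg zero)
       (simp add: tensor_def coset_add coset_zero)
  then show ?thesis
    using assms cl coset_closed by simp
qed

lemma tensor_group_induct:
  assumes t: "t \<in> carrier (tensor_group k M N)"
    and pure: "\<And>x y. x \<in> carrier M \<Longrightarrow> y \<in> carrier N \<Longrightarrow> P (tensor k M N x y)"
    and add: "\<And>s t. s \<in> carrier (tensor_group k M N) \<Longrightarrow> t \<in> carrier (tensor_group k M N) \<Longrightarrow>
       P s \<Longrightarrow> P t \<Longrightarrow> P (s \<otimes>\<^bsub>tensor_group k M N\<^esub> t)"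
  shows "P t"
proof -
  obtain c where c: "c \<in> carrier F" and t_eq: "t = coset c"
    using t by (auto simp: tensor_group_def carrier_FactGroup)
  have add': "P (coset (c + d))" if "c \<in> carrier F" "d \<in> carrier F" "P (coset c)" "P (coset d)" for c d
    using add [OF coset_closed coset_closed] that coset_add by metis
  have "P (coset c) \<and> P (coset (- c))"
  proof (rule free_Abelian_group_induct [of c "carrier M \<times> carrier N"])
    have "tensor k M N \<zero>\<^bsub>M\<^esub> \<zero>\<^bsub>N\<^esub> = coset 0"
      using tensor_add_left [of "\<zero>\<^bsub>M\<^esub>" "\<zero>\<^bsub>M\<^esub>" "\<zero>\<^bsub>N\<^esub>"] TG.l_cancel_one'
      by (simp add: coset_zero)
    then show "P (coset 0) \<and> P (coset (- 0))"
      using pure [OF M.zero_closed N.zero_closed] by simp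
  next
    fix x y
    assume "Poly_Mapping.keys x \<subseteq> carrier M \<times> carrier N" "Poly_Mapping.keys y \<subseteq> carrier M \<times> carrier N"
      and "P (coset x) \<and> P (coset (- x))" "P (coset y) \<and> P (coset (- y))"
    then show "P (coset (x - y)) \<and> P (coset (- (x - y)))"
      using add' [of x "- y"] add' [of y "- x"] by simp
  next
    fix z assume "z \<in> carrier M \<times> carrier N"
    then obtain x y where z: "z = (x, y)" "x \<in> carrier M" "y \<in> carrier N" by auto
    then show "P (coset (frag_of z)) \<and> P (coset (- frag_of z))"
      using pure [of x y] pure [of "\<ominus>\<^bsub>M\<^esub> x" y] by (simp add: tensor_uminus_left) (simp add: tensor_def)
  qed (use c in auto)
  then show ?thesis using t_eq by blast
qed

context
  fixes G :: "('c, 'g) monoid_scheme" and h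
  assumes G: "comm_group G" and h: "balanced_map k M N G h"
begin

interpretation G: comm_group G by (rule G)

text \<open>
  The three families of relations are exactly the three conditions on a balanced map; the kernel of
  the evaluation is a subgroup and therefore contains the subgroup that they generate.
\<close>

lemma balanced_eval_null:
  assumes "c \<in> tensor_null k M N"
  shows "formal_eval G (\<lambda>(x, y). h x y) c = \<one>\<^bsub>G\<^esub>"
proof -
  let ?e = "formal_eval G (\<lambda>(x, y). h x y)"
  have f: "(\<lambda>(x, y). h x y) \<in> carrier M \<times> carrier N \<rightarrow> carrier G"
    using h by (auto simp: balanced_map_def)
  interpret e: group_hom F G ?e
    by (intro group_hom.intro group_hom_axioms.intro G.formal_eval_hom f) unfold_locales
  have ef: "?e (frag_of (x, y)) = h x y" if "x \<in> carrier M" "y \<in> carrier N" for x y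
    using h that by (subst G.formal_eval_frag_of) (auto simp: balanced_map_def)
  have ed: "?e (a - b) = ?e a \<otimes>\<^bsub>G\<^esub> inv\<^bsub>G\<^esub> ?e b" if "a \<in> carrier F" "b \<in> carrier F" for a b
    using e.hom_mult [of a "- b"] e.hom_inv [of b] that by simp
  have dc: "a - b \<in> carrier F" if "a \<in> carrier F" "b \<in> carrier F" for a b :: "'a \<times> 'b \<Rightarrow>\<^sub>0 int"
    using F.m_closed [of a "- b"] that by simp
  have hc: "h x y \<in> carrier G" if "x \<in> carrier M" "y \<in> carrier N" for x y
    using h that by (auto simp: balanced_map_def)
  have cancel: "(a \<otimes>\<^bsub>G\<^esub> b) \<otimes>\<^bsub>G\<^esub> inv\<^bsub>G\<^esub> a \<otimes>\<^bsub>G\<^esub> inv\<^bsub>G\<^esub> b = \<one>\<^bsub>G\<^esub>"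
    if "a \<in> carrier G" "b \<in> carrier G" for a b
    using that by (metis G.inv_closed G.inv_mult G.m_assoc G.m_closed G.r_inv)
  have "c \<in> kernel F G ?e" if "c \<in> tensor_relations k M N" for c
  proof -
    have "c \<in> carrier F"
      using that tensor_relations_subset by blast
    moreover have "?e c = \<one>\<^bsub>G\<^esub>"
      using that unfolding tensor_relations_def
    proof (elim UnE CollectE exE conjE)
      fix x x' y
      assume c: "c = frag_of (x \<oplus>\<^bsub>M\<^esub> x', y) - frag_of (x, y) - frag_of (x', y)"
        and xy: "x \<in> carrier M" "x' \<in> carrier M" "y \<in> carrier N"
      have "h (x \<oplus>\<^bsub>M\<^esub> x') y = h x y \<otimes>\<^bsub>G\<^esub> h x' y"
        using h xy by (auto simp: balanced_map_def)
      then show ?thesis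
        unfolding c using xy by (subst ed; (subst ed)?)
          (auto simp: ef cancel hc intro!: dc simp del: carrier_free_Abelian_group_iff)
    next
      fix x y y'
      assume c: "c = frag_of (x, y \<oplus>\<^bsub>N\<^esub> y') - frag_of (x, y) - frag_of (x, y')"
        and xy: "x \<in> carrier M" "y \<in> carrier N" "y' \<in> carrier N"
      have "h x (y \<oplus>\<^bsub>N\<^esub> y') = h x y \<otimes>\<^bsub>G\<^esub> h x y'"
        using h xy by (auto simp: balanced_map_def)
      then show ?thesis
        unfolding c using xy by (subst ed; (subst ed)?)
          (auto simp: ef cancel hc intro!: dc simp del: carrier_free_Abelian_group_iff)
    next
      fix r x y
      assume c: "c = frag_of (r \<odot>\<^bsub>M\<^esub> x, y) - frag_of (x, r \<odot>\<^bsub>N\<^esub> y)"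
        and xy: "r \<in> carrier k" "x \<in> carrier M" "y \<in> carrier N"
      have "h (r \<odot>\<^bsub>M\<^esub> x) y = h x (r \<odot>\<^bsub>N\<^esub> y)"
        using h xy by (auto simp: balanced_map_def)
      then show ?thesis
        unfolding c using xy by (subst ed) (auto simp: ef hc)
    qed
    ultimately show ?thesis
      by (simp add: kernel_def)
  qed
  then have "tensor_relations k M N \<subseteq> kernel F G ?e"
    by blast
  then have "tensor_null k M N \<subseteq> kernel F G ?e"
    unfolding tensor_null_def by (rule F.generate_subgroup_incl) (rule e.subgroup_kernel)
  then show ?thesis
    using assms by (auto simp: kernel_def)
qed

lemma tensor_lift_coset:
  assumes c: "c \<in> carrier F"
  shows "tensor_lift G h (coset c) = formal_eval G (\<lambda>(x, y). h x y) c"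
proof -
  let ?e = "formal_eval G (\<lambda>(x, y). h x y)"
  have f: "(\<lambda>(x, y). h x y) \<in> carrier M \<times> carrier N \<rightarrow> carrier G"
    using h by (auto simp: balanced_map_def)
  interpret e: group_hom F G ?e
    by (intro group_hom.intro group_hom_axioms.intro G.formal_eval_hom f) unfold_locales
  have "?e (n + c) = ?e c" if "n \<in> tensor_null k M N" for n
    using e.hom_mult [of n c] that c Q.subset balanced_eval_null [OF that] e.hom_closed [OF c] by auto
  moreover have "0 \<in> tensor_null k M N"
    using Q.one_closed by simp
  ultimately have "?e ` coset c = {?e c}"
    unfolding r_coset_def by (auto simp: image_iff) 
  then show ?thesis
    unfolding tensor_lift_def by (simp add: formal_eval_def case_prod_unfold)
qed

lemma tensor_lift_tensor:
  assumes "x \<in> carrier M" "y \<in> carrier N"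
  shows "tensor_lift G h (tensor k M N x y) = h x y"
  unfolding tensor_def using assms h
  by (subst tensor_lift_coset) (auto simp: G.formal_eval_frag_of balanced_map_def)

lemma tensor_lift_hom: "tensor_lift G h \<in> hom (tensor_group k M N) G"
proof -
  let ?e = "formal_eval G (\<lambda>(x, y). h x y)"
  have f: "(\<lambda>(x, y). h x y) \<in> carrier M \<times> carrier N \<rightarrow> carrier G"
    using h by (auto simp: balanced_map_def)
  interpret e: group_hom F G ?e
    by (intro group_hom.intro group_hom_axioms.intro G.formal_eval_hom f) unfold_locales
  show ?thesis
  proof (rule homI)
    fix s t assume "s \<in> carrier (tensor_group k M N)" "t \<in> carrier (tensor_group k M N)"
    then obtain c d where c: "c \<in> carrier F" "s = coset c" and d: "d \<in> carrier F" "t = coset d"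
      by (auto simp: tensor_group_def carrier_FactGroup)
    then show "tensor_lift G h (s \<otimes>\<^bsub>tensor_group k M N\<^esub> t) = tensor_lift G h s \<otimes>\<^bsub>G\<^esub> tensor_lift G h t"
      using e.hom_mult [of c d] formal_sum_closed [of c d] by (simp add: coset_add tensor_lift_coset)
  next
    fix s assume "s \<in> carrier (tensor_group k M N)"
    then show "tensor_lift G h s \<in> carrier G"
      using tensor_lift_coset e.hom_closed by (auto simp: tensor_group_def carrier_FactGroup)
  qed
qed

end

end

section \<open>The module structure on the tensor product\<close>

definition bilinear_map ::
    "('k, 'r) ring_scheme \<Rightarrow> ('k, 'a, 'm) module_scheme \<Rightarrow> ('k, 'b, 'n) module_scheme
      \<Rightarrow> ('k, 'c, 'p) module_scheme \<Rightarrow> ('a \<Rightarrow> 'b \<Rightarrow> 'c) \<Rightarrow> bool"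
  where "bilinear_map k M N P h \<longleftrightarrow>
     (\<forall>y \<in> carrier N. (\<lambda>x. h x y) \<in> module_hom k M P) \<and>
     (\<forall>x \<in> carrier M. h x \<in> module_hom k N P)"

lemma module_hom_closed: "f \<in> module_hom k M N \<Longrightarrow> x \<in> carrier M \<Longrightarrow> f x \<in> carrier N"
  by (auto simp: module_hom_def)

lemma module_hom_add:
  "f \<in> module_hom k M N \<Longrightarrow> x \<in> carrier M \<Longrightarrow> y \<in> carrier M \<Longrightarrow>
     f (x \<oplus>\<^bsub>M\<^esub> y) = f x \<oplus>\<^bsub>N\<^esub> f y"
  by (auto simp: module_hom_def)

lemma module_hom_smult:
  "f \<in> module_hom k M N \<Longrightarrow> r \<in> carrier k \<Longrightarrow> x \<in> carrier M \<Longrightarrow>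
     f (r \<odot>\<^bsub>M\<^esub> x) = r \<odot>\<^bsub>N\<^esub> f x"
  by (auto simp: module_hom_def)

lemma module_homI:
  "\<lbrakk>\<And>x. x \<in> carrier M \<Longrightarrow> f x \<in> carrier N;
    \<And>x y. x \<in> carrier M \<Longrightarrow> y \<in> carrier M \<Longrightarrow> f (x \<oplus>\<^bsub>M\<^esub> y) = f x \<oplus>\<^bsub>N\<^esub> f y;
    \<And>r x. r \<in> carrier k \<Longrightarrow> x \<in> carrier M \<Longrightarrow> f (r \<odot>\<^bsub>M\<^esub> x) = r \<odot>\<^bsub>N\<^esub> f x\<rbrakk>
     \<Longrightarrow> f \<in> module_hom k M N"
  by (auto simp: module_hom_def)

lemma module_hom_comp:
  "g \<in> module_hom k L M \<Longrightarrow> f \<in> module_hom k M N \<Longrightarrow> f \<circ> g \<in> module_hom k L N"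
  by (auto simp: module_hom_def Pi_iff)

lemma module_hom_id: "id \<in> module_hom k M M"
  by (auto simp: module_hom_def)

lemma carrier_tensor_product: "carrier (M \<boxtimes>\<^bsub>k\<^esub> N) = carrier (tensor_group k M N)"
  and add_tensor_product: "add (M \<boxtimes>\<^bsub>k\<^esub> N) = mult (tensor_group k M N)"
  by (simp_all add: tensor_product_def)

context module_pair
begin

lemma abelian_group_tensor: "abelian_group (M \<boxtimes> N)"
  by (rule abelian_groupI)
    (auto simp: tensor_product_def TG.m_ac intro: TG.l_inv_ex)

lemma smult_balanced:
  assumes r: "r \<in> carrier k"
  shows "balanced_map k M N (tensor_group k M N) (\<lambda>x y. tensor k M N (r \<odot>\<^bsub>M\<^esub> x) y)"
proof -
  have "tensor k M N (r \<odot>\<^bsub>M\<^esub> (q \<odot>\<^bsub>M\<^esub> x)) y = tensor k M N (r \<odot>\<^bsub>M\<^esub> x) (q \<odot>\<^bsub>N\<^esub> y)"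
    if "q \<in> carrier k" "x \<in> carrier M" "y \<in> carrier N" for q x y
    using that r tensor_balanced [of q "r \<odot>\<^bsub>M\<^esub> x" y] M.smult_assoc1 [of r q x] M.smult_assoc1 [of q r x]
      M.m_comm [of r q] by simp
  then show ?thesis
    unfolding balanced_map_def
    using r by (simp add: M.smult_r_distr tensor_add_left tensor_add_right)
qed

lemma smult_tensor:
  assumes "r \<in> carrier k" "x \<in> carrier M" "y \<in> carrier N"
  shows "r \<odot>\<^bsub>M \<boxtimes> N\<^esub> tensor k M N x y = tensor k M N (r \<odot>\<^bsub>M\<^esub> x) y"
  using assms tensor_lift_tensor [OF TG.comm_group_axioms smult_balanced]
  by (simp add: tensor_product_def)

lemma smult_tensor_hom:
  assumes "r \<in> carrier k"
  shows "smult (M \<boxtimes> N) r \<in> hom (tensor_group k M N) (tensor_group k M N)"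
  using tensor_lift_hom [OF TG.comm_group_axioms smult_balanced [OF assms]]
  by (simp add: tensor_product_def)

lemma tensor_mem [simp, intro]:
  "x \<in> carrier M \<Longrightarrow> y \<in> carrier N \<Longrightarrow> tensor k M N x y \<in> carrier (M \<boxtimes> N)"
  by (simp add: carrier_tensor_product)

lemmas tensor_plus_left = tensor_add_left [folded add_tensor_product]
lemmas tensor_plus_right = tensor_add_right [folded add_tensor_product]
lemmas tensor_induct = tensor_group_induct [folded add_tensor_product carrier_tensor_product,
  consumes 1, case_names pure add]

sublocale tensor: module k "M \<boxtimes> N"
proof (rule moduleI)
  interpret T: abelian_group "M \<boxtimes> N"
    by (rule abelian_group_tensor)
  show "cring k" ..
  show "abelian_group (M \<boxtimes> N)" ..
  have sc: "r \<odot>\<^bsub>M \<boxtimes> N\<^esub> t \<in> carrier (M \<boxtimes> N)" if "r \<in> carrier k" "t \<in> carrier (M \<boxtimes> N)" for r t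
    using smult_tensor_hom that by (auto simp: hom_def carrier_tensor_product)
  have sa: "r \<odot>\<^bsub>M \<boxtimes> N\<^esub> (s \<oplus>\<^bsub>M \<boxtimes> N\<^esub> t) = r \<odot>\<^bsub>M \<boxtimes> N\<^esub> s \<oplus>\<^bsub>M \<boxtimes> N\<^esub> r \<odot>\<^bsub>M \<boxtimes> N\<^esub> t"
    if "r \<in> carrier k" "s \<in> carrier (M \<boxtimes> N)" "t \<in> carrier (M \<boxtimes> N)" for r s t
    using smult_tensor_hom that by (auto simp: hom_def carrier_tensor_product add_tensor_product)
  show "\<one> \<odot>\<^bsub>M \<boxtimes> N\<^esub> s = s" if "s \<in> carrier (M \<boxtimes> N)" for s
    using that by (induct s rule: tensor_induct) (simp_all add: smult_tensor sa)
  fix a b s t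
  assume ab: "a \<in> carrier k" "b \<in> carrier k" and s: "s \<in> carrier (M \<boxtimes> N)"
  show "a \<odot>\<^bsub>M \<boxtimes> N\<^esub> s \<in> carrier (M \<boxtimes> N)"
    by (rule sc [OF ab(1) s])
  show "(a \<oplus> b) \<odot>\<^bsub>M \<boxtimes> N\<^esub> s = a \<odot>\<^bsub>M \<boxtimes> N\<^esub> s \<oplus>\<^bsub>M \<boxtimes> N\<^esub> b \<odot>\<^bsub>M \<boxtimes> N\<^esub> s"
    using s by (induct s rule: tensor_induct)
      (use ab in \<open>simp_all add: smult_tensor M.smult_l_distr tensor_plus_left sa sc T.a_ac\<close>)
  show "(a \<otimes> b) \<odot>\<^bsub>M \<boxtimes> N\<^esub> s = a \<odot>\<^bsub>M \<boxtimes> N\<^esub> (b \<odot>\<^bsub>M \<boxtimes> N\<^esub> s)"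
    using s by (induct s rule: tensor_induct)
      (use ab in \<open>simp_all add: smult_tensor M.smult_assoc1 sa sc\<close>)
  assume "t \<in> carrier (M \<boxtimes> N)"
  then show "a \<odot>\<^bsub>M \<boxtimes> N\<^esub> (s \<oplus>\<^bsub>M \<boxtimes> N\<^esub> t) = a \<odot>\<^bsub>M \<boxtimes> N\<^esub> s \<oplus>\<^bsub>M \<boxtimes> N\<^esub> a \<odot>\<^bsub>M \<boxtimes> N\<^esub> t"
    by (rule sa [OF ab(1) s])
qed

lemma tensor_module_hom_left:
  "y \<in> carrier N \<Longrightarrow> (\<lambda>x. tensor k M N x y) \<in> module_hom k M (M \<boxtimes> N)"
  by (rule module_homI) (auto simp: tensor_plus_left smult_tensor)

lemma tensor_module_hom_right:
  "x \<in> carrier M \<Longrightarrow> tensor k M N x \<in> module_hom k N (M \<boxtimes> N)"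
  by (rule module_homI) (auto simp: tensor_plus_right smult_tensor tensor_balanced)

lemma module_hom_tensor_eqI:
  assumes "f \<in> module_hom k (M \<boxtimes> N) P" "g \<in> module_hom k (M \<boxtimes> N) P"
    and "\<And>x y. x \<in> carrier M \<Longrightarrow> y \<in> carrier N \<Longrightarrow> f (tensor k M N x y) = g (tensor k M N x y)"
  shows "f \<doteq>\<^bsub>M \<boxtimes> N\<^esub> g"
  unfolding map_eq_def
proof
  fix t assume "t \<in> carrier (M \<boxtimes> N)"
  then show "f t = g t"
    by (induct t rule: tensor_induct)
       (simp_all add: assms(3) module_hom_add [OF assms(1)] module_hom_add [OF assms(2)])
qed

text \<open>
  Linear maps occur with two kinds of target group: the additive group of a module, and, when the
  target is a tensor product, the multiplicatively written quotient group that underlies it.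
\<close>

context
  fixes P :: "('k, 'c, 'p) module_scheme" and h :: "'a \<Rightarrow> 'b \<Rightarrow> 'c"
    and G :: "('c, 'g) monoid_scheme"
  assumes P: "module k P" and h: "bilinear_map k M N P h"
    and G: "comm_group G" and GP: "carrier G = carrier P" "mult G = add P"
begin

lemma bilinear_balanced: "balanced_map k M N G h"
proof -
  have 1: "(\<lambda>x. h x y) \<in> module_hom k M P" if "y \<in> carrier N" for y
    using h that by (simp add: bilinear_map_def)
  have 2: "h x \<in> module_hom k N P" if "x \<in> carrier M" for x
    using h that by (simp add: bilinear_map_def)
  show ?thesis
    unfolding balanced_map_def GP
    using module_hom_closed [OF 2] module_hom_add [OF 1] module_hom_add [OF 2]
      module_hom_smult [OF 1] module_hom_smult [OF 2] by simp
qed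

lemma tensor_lift_module_hom: "tensor_lift G h \<in> module_hom k (M \<boxtimes> N) P"
proof -
  interpret P: module k P by (rule P)
  have 1: "(\<lambda>x. h x y) \<in> module_hom k M P" if "y \<in> carrier N" for y
    using h that by (simp add: bilinear_map_def)
  note lift = tensor_lift_tensor [OF G bilinear_balanced]
  have H: "tensor_lift G h \<in> hom (tensor_group k M N) G"
    by (rule tensor_lift_hom [OF G bilinear_balanced])
  have cl: "tensor_lift G h t \<in> carrier P" if "t \<in> carrier (M \<boxtimes> N)" for t
    using H that by (auto simp: hom_def carrier_tensor_product GP)
  have ad: "tensor_lift G h (s \<oplus>\<^bsub>M \<boxtimes> N\<^esub> t) = tensor_lift G h s \<oplus>\<^bsub>P\<^esub> tensor_lift G h t"
    if "s \<in> carrier (M \<boxtimes> N)" "t \<in> carrier (M \<boxtimes> N)" for s t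
    using H that by (auto simp: hom_def carrier_tensor_product add_tensor_product GP)
  show ?thesis
  proof (rule module_homI)
    fix r t assume r: "r \<in> carrier k" and "t \<in> carrier (M \<boxtimes> N)"
    from this(2) show "tensor_lift G h (r \<odot>\<^bsub>M \<boxtimes> N\<^esub> t) = r \<odot>\<^bsub>P\<^esub> tensor_lift G h t"
    proof (induct t rule: tensor_induct)
      case (pure x y)
      then show ?case
        using r module_hom_smult [OF 1 r] by (simp add: smult_tensor lift)
    next
      case (add s t)
      then show ?case
        using r by (simp add: tensor.smult_r_distr ad cl P.smult_r_distr)
    qed
  qed (use cl ad in auto)
qed

end

lemma bilinear_lift_group:
  assumes "module k P" "bilinear_map k M N P h"
  shows "tensor_lift (add_monoid P) h \<in> module_hom k (M \<boxtimes> N) P"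
    and "x \<in> carrier M \<Longrightarrow> y \<in> carrier N \<Longrightarrow> tensor_lift (add_monoid P) h (tensor k M N x y) = h x y"
proof -
  interpret P: module k P by (rule assms)
  have G: "comm_group (add_monoid P)" by (rule P.a_comm_group)
  show "tensor_lift (add_monoid P) h \<in> module_hom k (M \<boxtimes> N) P"
    by (rule tensor_lift_module_hom [OF assms G]) simp_all
  show "tensor_lift (add_monoid P) h (tensor k M N x y) = h x y"
    if "x \<in> carrier M" "y \<in> carrier N"
    by (rule tensor_lift_tensor [OF G bilinear_balanced [OF assms G]]) (simp_all add: that)
qed

lemma bilinear_lift_tensor:
  assumes "module k P" "module k Q" "bilinear_map k M N (P \<boxtimes> Q) h"
  shows "tensor_lift (tensor_group k P Q) h \<in> module_hom k (M \<boxtimes> N) (P \<boxtimes> Q)"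
    and "x \<in> carrier M \<Longrightarrow> y \<in> carrier N \<Longrightarrow> tensor_lift (tensor_group k P Q) h (tensor k M N x y) = h x y"
proof -
  interpret PQ: module_pair k P Q using assms by (simp add: module_pair_def)
  note GP = carrier_tensor_product [symmetric] add_tensor_product [symmetric]
  show "tensor_lift (tensor_group k P Q) h \<in> module_hom k (M \<boxtimes> N) (P \<boxtimes> Q)"
    by (rule tensor_lift_module_hom [OF PQ.tensor.module_axioms assms(3) PQ.TG.comm_group_axioms GP])
  show "tensor_lift (tensor_group k P Q) h (tensor k M N x y) = h x y"
    if "x \<in> carrier M" "y \<in> carrier N"
    by (rule tensor_lift_tensor [OF PQ.TG.comm_group_axioms
          bilinear_balanced [OF PQ.tensor.module_axioms assms(3) PQ.TG.comm_group_axioms GP] that])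
qed

end

section \<open>The canonical maps between tensor products\<close>

lemma module_tensor:
  assumes "module k M" "module k N"
  shows "module k (M \<boxtimes>\<^bsub>k\<^esub> N)"
proof -
  interpret module_pair k M N using assms by (simp add: module_pair_def)
  show ?thesis by (rule tensor.module_axioms)
qed

lemma tensor_in_carrier:
  "module k M \<Longrightarrow> module k N \<Longrightarrow> x \<in> carrier M \<Longrightarrow> y \<in> carrier N \<Longrightarrow>
     tensor k M N x y \<in> carrier (M \<boxtimes>\<^bsub>k\<^esub> N)"
  by (rule module_pair.tensor_mem) (auto simp: module_pair_def)

lemma tensor_hom_left:
  "module k M \<Longrightarrow> module k N \<Longrightarrow> y \<in> carrier N \<Longrightarrow>
     (\<lambda>x. tensor k M N x y) \<in> module_hom k M (M \<boxtimes>\<^bsub>k\<^esub> N)"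
  by (rule module_pair.tensor_module_hom_left) (auto simp: module_pair_def)

lemma tensor_hom_right:
  "module k M \<Longrightarrow> module k N \<Longrightarrow> x \<in> carrier M \<Longrightarrow>
     tensor k M N x \<in> module_hom k N (M \<boxtimes>\<^bsub>k\<^esub> N)"
  by (rule module_pair.tensor_module_hom_right) (auto simp: module_pair_def)

lemma module_hom_lambda_comp:
  "g \<in> module_hom k L M \<Longrightarrow> f \<in> module_hom k M N \<Longrightarrow> (\<lambda>x. f (g x)) \<in> module_hom k L N"
  using module_hom_comp by (simp add: comp_def)

lemma tensor_smult:
  "module k M \<Longrightarrow> module k N \<Longrightarrow> r \<in> carrier k \<Longrightarrow> x \<in> carrier M \<Longrightarrow> y \<in> carrier N \<Longrightarrow>
     tensor k M N (r \<odot>\<^bsub>M\<^esub> x) y = tensor k M N x (r \<odot>\<^bsub>N\<^esub> y)"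
  by (rule module_pair.tensor_balanced) (auto simp: module_pair_def)

lemma hom_tensor_eqI:
  assumes "module k M" "module k N"
    and "f \<in> module_hom k (M \<boxtimes>\<^bsub>k\<^esub> N) P" "g \<in> module_hom k (M \<boxtimes>\<^bsub>k\<^esub> N) P"
    and "\<And>x y. x \<in> carrier M \<Longrightarrow> y \<in> carrier N \<Longrightarrow> f (tensor k M N x y) = g (tensor k M N x y)"
  shows "f \<doteq>\<^bsub>M \<boxtimes>\<^bsub>k\<^esub> N\<^esub> g"
  by (rule module_pair.module_hom_tensor_eqI) (use assms in \<open>auto simp: module_pair_def\<close>)

lemma hom_tensor_cong:
  assumes "module k M" "module k N"
    and "f \<in> module_hom k (M \<boxtimes>\<^bsub>k\<^esub> N) P" "g \<in> module_hom k (M \<boxtimes>\<^bsub>k\<^esub> N) P"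
    and "\<And>x y. x \<in> carrier M \<Longrightarrow> y \<in> carrier N \<Longrightarrow> f (tensor k M N x y) = g (tensor k M N x y)"
    and "t \<in> carrier (M \<boxtimes>\<^bsub>k\<^esub> N)"
  shows "f t = g t"
  using hom_tensor_eqI [OF assms(1-5)] assms(6) by (simp add: map_eq_def)

lemma map_eq_refl: "f \<doteq>\<^bsub>M\<^esub> f"
  by (simp add: map_eq_def)

lemma map_eq_sym: "f \<doteq>\<^bsub>M\<^esub> g \<Longrightarrow> g \<doteq>\<^bsub>M\<^esub> f"
  by (simp add: map_eq_def)

lemma map_eq_trans: "f \<doteq>\<^bsub>M\<^esub> g \<Longrightarrow> g \<doteq>\<^bsub>M\<^esub> h \<Longrightarrow> f \<doteq>\<^bsub>M\<^esub> h"
  by (simp add: map_eq_def)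

lemma map_eqD: "f \<doteq>\<^bsub>M\<^esub> g \<Longrightarrow> x \<in> carrier M \<Longrightarrow> f x = g x"
  by (simp add: map_eq_def)

lemma hom_tensor3_left_eqI:
  assumes mods: "module k M" "module k N" "module k P"
    and f: "f \<in> module_hom k ((M \<boxtimes>\<^bsub>k\<^esub> N) \<boxtimes>\<^bsub>k\<^esub> P) Q"
    and g: "g \<in> module_hom k ((M \<boxtimes>\<^bsub>k\<^esub> N) \<boxtimes>\<^bsub>k\<^esub> P) Q"
    and eq: "\<And>x y z. x \<in> carrier M \<Longrightarrow> y \<in> carrier N \<Longrightarrow> z \<in> carrier P \<Longrightarrow>
       f (tensor k (M \<boxtimes>\<^bsub>k\<^esub> N) P (tensor k M N x y) z)
         = g (tensor k (M \<boxtimes>\<^bsub>k\<^esub> N) P (tensor k M N x y) z)"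
  shows "f \<doteq>\<^bsub>(M \<boxtimes>\<^bsub>k\<^esub> N) \<boxtimes>\<^bsub>k\<^esub> P\<^esub> g"
proof (rule hom_tensor_eqI [OF module_tensor [OF mods(1,2)] mods(3) f g])
  fix u z assume u: "u \<in> carrier (M \<boxtimes>\<^bsub>k\<^esub> N)" and z: "z \<in> carrier P"
  note t = tensor_hom_left [OF module_tensor [OF mods(1,2)] mods(3) z]
  show "f (tensor k (M \<boxtimes>\<^bsub>k\<^esub> N) P u z) = g (tensor k (M \<boxtimes>\<^bsub>k\<^esub> N) P u z)"
    by (rule hom_tensor_cong [OF mods(1,2) module_hom_lambda_comp [OF t f]
          module_hom_lambda_comp [OF t g] _ u]) (rule eq [OF _ _ z])
qed

lemma hom_tensor3_right_eqI:
  assumes mods: "module k M" "module k N" "module k P"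
    and f: "f \<in> module_hom k (M \<boxtimes>\<^bsub>k\<^esub> (N \<boxtimes>\<^bsub>k\<^esub> P)) Q"
    and g: "g \<in> module_hom k (M \<boxtimes>\<^bsub>k\<^esub> (N \<boxtimes>\<^bsub>k\<^esub> P)) Q"
    and eq: "\<And>x y z. x \<in> carrier M \<Longrightarrow> y \<in> carrier N \<Longrightarrow> z \<in> carrier P \<Longrightarrow>
       f (tensor k M (N \<boxtimes>\<^bsub>k\<^esub> P) x (tensor k N P y z))
         = g (tensor k M (N \<boxtimes>\<^bsub>k\<^esub> P) x (tensor k N P y z))"
  shows "f \<doteq>\<^bsub>M \<boxtimes>\<^bsub>k\<^esub> (N \<boxtimes>\<^bsub>k\<^esub> P)\<^esub> g"
proof (rule hom_tensor_eqI [OF mods(1) module_tensor [OF mods(2,3)] f g])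
  fix x u assume x: "x \<in> carrier M" and u: "u \<in> carrier (N \<boxtimes>\<^bsub>k\<^esub> P)"
  note t = tensor_hom_right [OF mods(1) module_tensor [OF mods(2,3)] x]
  show "f (tensor k M (N \<boxtimes>\<^bsub>k\<^esub> P) x u) = g (tensor k M (N \<boxtimes>\<^bsub>k\<^esub> P) x u)"
    by (rule hom_tensor_cong [OF mods(2,3) module_hom_lambda_comp [OF t f]
          module_hom_lambda_comp [OF t g] _ u]) (rule eq [OF x])
qed

lemma hom_tensor4_eqI:
  assumes mods: "module k L" "module k M" "module k N" "module k P"
    and f: "f \<in> module_hom k ((L \<boxtimes>\<^bsub>k\<^esub> M) \<boxtimes>\<^bsub>k\<^esub> (N \<boxtimes>\<^bsub>k\<^esub> P)) Q"
    and g: "g \<in> module_hom k ((L \<boxtimes>\<^bsub>k\<^esub> M) \<boxtimes>\<^bsub>k\<^esub> (N \<boxtimes>\<^bsub>k\<^esub> P)) Q"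
    and eq: "\<And>w x y z. w \<in> carrier L \<Longrightarrow> x \<in> carrier M \<Longrightarrow> y \<in> carrier N \<Longrightarrow> z \<in> carrier P \<Longrightarrow>
       f (tensor k (L \<boxtimes>\<^bsub>k\<^esub> M) (N \<boxtimes>\<^bsub>k\<^esub> P) (tensor k L M w x) (tensor k N P y z))
         = g (tensor k (L \<boxtimes>\<^bsub>k\<^esub> M) (N \<boxtimes>\<^bsub>k\<^esub> P) (tensor k L M w x) (tensor k N P y z))"
  shows "f \<doteq>\<^bsub>(L \<boxtimes>\<^bsub>k\<^esub> M) \<boxtimes>\<^bsub>k\<^esub> (N \<boxtimes>\<^bsub>k\<^esub> P)\<^esub> g"
proof (rule hom_tensor3_left_eqI [OF mods(1,2) module_tensor [OF mods(3,4)] f g])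
  fix w x u assume w: "w \<in> carrier L" and x: "x \<in> carrier M" and u: "u \<in> carrier (N \<boxtimes>\<^bsub>k\<^esub> P)"
  note t = tensor_hom_right [OF module_tensor [OF mods(1,2)] module_tensor [OF mods(3,4)]
      tensor_in_carrier [OF mods(1,2) w x]]
  show "f (tensor k (L \<boxtimes>\<^bsub>k\<^esub> M) (N \<boxtimes>\<^bsub>k\<^esub> P) (tensor k L M w x) u)
      = g (tensor k (L \<boxtimes>\<^bsub>k\<^esub> M) (N \<boxtimes>\<^bsub>k\<^esub> P) (tensor k L M w x) u)"
    by (rule hom_tensor_cong [OF mods(3,4) module_hom_lambda_comp [OF t f]
          module_hom_lambda_comp [OF t g] _ u]) (rule eq [OF w x])
qed

text \<open>
  For the associator, whose inner \<open>tensor_lift\<close> depends on an element \<open>z\<close> of the third module: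
  linearity in \<open>z\<close> holds at every tensor as soon as it holds at pure ones.
\<close>

lemma module_hom_tensor_parameter:
  assumes mods: "module k M" "module k N" and P: "module k P" and Q: "module k Q"
    and H: "\<And>z. z \<in> carrier P \<Longrightarrow> H z \<in> module_hom k (M \<boxtimes>\<^bsub>k\<^esub> N) Q"
    and pure: "\<And>x y. x \<in> carrier M \<Longrightarrow> y \<in> carrier N \<Longrightarrow>
       (\<lambda>z. H z (tensor k M N x y)) \<in> module_hom k P Q"
    and u: "u \<in> carrier (M \<boxtimes>\<^bsub>k\<^esub> N)"
  shows "(\<lambda>z. H z u) \<in> module_hom k P Q"
proof -
  interpret MN: module_pair k M N using mods by (simp add: module_pair_def)
  interpret P: module k P by (rule P)
  interpret Q: module k Q by (rule Q)
  show ?thesis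
    using u
  proof (induct u rule: MN.tensor_induct)
    case (add s t)
    have st: "H z (s \<oplus>\<^bsub>M \<boxtimes>\<^bsub>k\<^esub> N\<^esub> t) = H z s \<oplus>\<^bsub>Q\<^esub> H z t" if "z \<in> carrier P" for z
      using H [OF that] add by (simp add: module_hom_add)
    have cl: "H z v \<in> carrier Q" if "z \<in> carrier P" "v \<in> carrier (M \<boxtimes>\<^bsub>k\<^esub> N)" for z v
      using H [OF that(1)] that(2) by (rule module_hom_closed)
    show ?case
      using add cl st unfolding module_hom_def by (auto simp: Q.a_ac Q.smult_r_distr)
  qed (use pure in auto)
qed

lemma scalars_simps [simp]:
  "carrier (scalars k) = carrier k" "add (scalars k) = add k" "zero (scalars k) = zero k"
  "smult (scalars k) = mult k"
  by (simp_all add: scalars_def)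

lemma module_scalars:
  assumes "cring k"
  shows "module k (scalars k)"
proof -
  interpret k: cring k by (rule assms)
  show ?thesis
    by (rule moduleI [OF assms])
      (auto simp: k.l_distr k.r_distr k.m_assoc k.a_ac k.l_neg intro!: abelian_groupI k.add.l_inv_ex)
qed

lemma tensor_map_bilinear:
  assumes "f \<in> module_hom k M M'" "g \<in> module_hom k N N'" "module k M'" "module k N'"
  shows "bilinear_map k M N (M' \<boxtimes>\<^bsub>k\<^esub> N') (\<lambda>x y. tensor k M' N' (f x) (g y))"
  unfolding bilinear_map_def
proof (intro conjI ballI)
  show "(\<lambda>x. tensor k M' N' (f x) (g y)) \<in> module_hom k M (M' \<boxtimes>\<^bsub>k\<^esub> N')" if "y \<in> carrier N" for y
    by (rule module_hom_lambda_comp [OF assms(1) tensor_hom_left])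
      (use assms that in \<open>auto intro: module_hom_closed\<close>)
  show "(\<lambda>y. tensor k M' N' (f x) (g y)) \<in> module_hom k N (M' \<boxtimes>\<^bsub>k\<^esub> N')" if "x \<in> carrier M" for x
    by (rule module_hom_lambda_comp [OF assms(2) tensor_hom_right])
      (use assms that in \<open>auto intro: module_hom_closed\<close>)
qed

lemma
  assumes "f \<in> module_hom k M M'" "g \<in> module_hom k N N'"
    and "module k M" "module k N" "module k M'" "module k N'"
  shows tensor_map_hom: "tensor_map k M' N' f g \<in> module_hom k (M \<boxtimes>\<^bsub>k\<^esub> N) (M' \<boxtimes>\<^bsub>k\<^esub> N')"
    and tensor_map_tensor: "x \<in> carrier M \<Longrightarrow> y \<in> carrier N \<Longrightarrow>
       tensor_map k M' N' f g (tensor k M N x y) = tensor k M' N' (f x) (g y)"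
  using module_pair.bilinear_lift_tensor [OF _ assms(5,6) tensor_map_bilinear [OF assms(1,2,5,6)]] assms(3,4)
  by (auto simp: tensor_map_def module_pair_def)

lemma
  assumes "module k M" "module k N"
  shows tensor_swap_hom: "tensor_swap k M N \<in> module_hom k (M \<boxtimes>\<^bsub>k\<^esub> N) (N \<boxtimes>\<^bsub>k\<^esub> M)"
    and tensor_swap_tensor: "x \<in> carrier M \<Longrightarrow> y \<in> carrier N \<Longrightarrow>
       tensor_swap k M N (tensor k M N x y) = tensor k N M y x"
proof -
  have "bilinear_map k M N (N \<boxtimes>\<^bsub>k\<^esub> M) (\<lambda>x y. tensor k N M y x)"
    using assms by (simp add: bilinear_map_def tensor_hom_left tensor_hom_right)
  then show "tensor_swap k M N \<in> module_hom k (M \<boxtimes>\<^bsub>k\<^esub> N) (N \<boxtimes>\<^bsub>k\<^esub> M)"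
    and "x \<in> carrier M \<Longrightarrow> y \<in> carrier N \<Longrightarrow>
       tensor_swap k M N (tensor k M N x y) = tensor k N M y x"
    using module_pair.bilinear_lift_tensor [of k M N N M] assms
    by (auto simp: tensor_swap_def module_pair_def)
qed

lemma
  assumes mods: "module k M" "module k N" "module k P"
  shows assoc_hom:
      "assoc k M N P \<in> module_hom k ((M \<boxtimes>\<^bsub>k\<^esub> N) \<boxtimes>\<^bsub>k\<^esub> P) (M \<boxtimes>\<^bsub>k\<^esub> (N \<boxtimes>\<^bsub>k\<^esub> P))"
    and assoc_tensor: "x \<in> carrier M \<Longrightarrow> y \<in> carrier N \<Longrightarrow> z \<in> carrier P \<Longrightarrow>
       assoc k M N P (tensor k (M \<boxtimes>\<^bsub>k\<^esub> N) P (tensor k M N x y) z)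
         = tensor k M (N \<boxtimes>\<^bsub>k\<^esub> P) x (tensor k N P y z)"
proof -
  interpret MN: module_pair k M N using mods by (simp add: module_pair_def)
  note NP = module_tensor [OF mods(2,3)]
  note Q = module_tensor [OF mods(1) NP]
  interpret MNP: module_pair k "M \<boxtimes>\<^bsub>k\<^esub> N" P
    using mods by (simp add: module_pair_def module_tensor)
  let ?H = "\<lambda>z. tensor_lift (tensor_group k M (N \<boxtimes>\<^bsub>k\<^esub> P))
    (\<lambda>x y. tensor k M (N \<boxtimes>\<^bsub>k\<^esub> P) x (tensor k N P y z))"
  have "bilinear_map k M N (M \<boxtimes>\<^bsub>k\<^esub> (N \<boxtimes>\<^bsub>k\<^esub> P))
      (\<lambda>x y. tensor k M (N \<boxtimes>\<^bsub>k\<^esub> P) x (tensor k N P y z))" if "z \<in> carrier P" for z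
    unfolding bilinear_map_def using that mods NP
    by (auto intro!: tensor_hom_left tensor_in_carrier
        module_hom_lambda_comp [OF tensor_hom_left tensor_hom_right])
  note lift = MN.bilinear_lift_tensor [OF mods(1) NP this]
  have param: "(\<lambda>z. ?H z u) \<in> module_hom k P (M \<boxtimes>\<^bsub>k\<^esub> (N \<boxtimes>\<^bsub>k\<^esub> P))"
    if "u \<in> carrier (M \<boxtimes>\<^bsub>k\<^esub> N)" for u
  proof (rule module_hom_tensor_parameter [OF mods(1,2,3) Q _ _ that])
    fix x y assume xy: "x \<in> carrier M" "y \<in> carrier N"
    have "(\<lambda>z. tensor k M (N \<boxtimes>\<^bsub>k\<^esub> P) x (tensor k N P y z)) \<in> module_hom k P (M \<boxtimes>\<^bsub>k\<^esub> (N \<boxtimes>\<^bsub>k\<^esub> P))"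
      using xy mods NP
      by (auto intro!: module_hom_lambda_comp [OF tensor_hom_right tensor_hom_right])
    then show "(\<lambda>z. ?H z (tensor k M N x y)) \<in> module_hom k P (M \<boxtimes>\<^bsub>k\<^esub> (N \<boxtimes>\<^bsub>k\<^esub> P))"
      using lift(2) xy mods unfolding module_hom_def by (simp add: Pi_iff MNP.N.a_closed)
  qed (rule lift(1))
  have "bilinear_map k (M \<boxtimes>\<^bsub>k\<^esub> N) P (M \<boxtimes>\<^bsub>k\<^esub> (N \<boxtimes>\<^bsub>k\<^esub> P)) (\<lambda>u z. ?H z u)"
    unfolding bilinear_map_def using lift(1) param by simp
  note outer = MNP.bilinear_lift_tensor [OF mods(1) NP this]
  show "assoc k M N P \<in> module_hom k ((M \<boxtimes>\<^bsub>k\<^esub> N) \<boxtimes>\<^bsub>k\<^esub> P) (M \<boxtimes>\<^bsub>k\<^esub> (N \<boxtimes>\<^bsub>k\<^esub> P))"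
    using outer(1) by (simp add: assoc_def Let_def)
  show "assoc k M N P (tensor k (M \<boxtimes>\<^bsub>k\<^esub> N) P (tensor k M N x y) z)
      = tensor k M (N \<boxtimes>\<^bsub>k\<^esub> P) x (tensor k N P y z)"
    if "x \<in> carrier M" "y \<in> carrier N" "z \<in> carrier P"
    using outer(2) [of "tensor k M N x y" z] lift(2) that by (simp add: assoc_def Let_def)
qed

lemma
  assumes mods: "module k M" "module k N" "module k P"
  shows assoc_inv_hom:
      "assoc_inv k M N P \<in> module_hom k (M \<boxtimes>\<^bsub>k\<^esub> (N \<boxtimes>\<^bsub>k\<^esub> P)) ((M \<boxtimes>\<^bsub>k\<^esub> N) \<boxtimes>\<^bsub>k\<^esub> P)"
    and assoc_inv_tensor: "x \<in> carrier M \<Longrightarrow> y \<in> carrier N \<Longrightarrow> z \<in> carrier P \<Longrightarrow>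
       assoc_inv k M N P (tensor k M (N \<boxtimes>\<^bsub>k\<^esub> P) x (tensor k N P y z))
         = tensor k (M \<boxtimes>\<^bsub>k\<^esub> N) P (tensor k M N x y) z"
proof -
  interpret NP: module_pair k N P using mods by (simp add: module_pair_def)
  note MN = module_tensor [OF mods(1,2)]
  note Q = module_tensor [OF MN mods(3)]
  interpret MNP: module_pair k M "N \<boxtimes>\<^bsub>k\<^esub> P"
    using mods by (simp add: module_pair_def module_tensor)
  let ?H = "\<lambda>x. tensor_lift (tensor_group k (M \<boxtimes>\<^bsub>k\<^esub> N) P)
    (\<lambda>y z. tensor k (M \<boxtimes>\<^bsub>k\<^esub> N) P (tensor k M N x y) z)"
  have "bilinear_map k N P ((M \<boxtimes>\<^bsub>k\<^esub> N) \<boxtimes>\<^bsub>k\<^esub> P)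
      (\<lambda>y z. tensor k (M \<boxtimes>\<^bsub>k\<^esub> N) P (tensor k M N x y) z)" if "x \<in> carrier M" for x
    unfolding bilinear_map_def using that mods MN
    by (auto intro!: tensor_hom_right tensor_in_carrier
        module_hom_lambda_comp [OF tensor_hom_right tensor_hom_left])
  note lift = NP.bilinear_lift_tensor [OF MN mods(3) this]
  have param: "(\<lambda>x. ?H x u) \<in> module_hom k M ((M \<boxtimes>\<^bsub>k\<^esub> N) \<boxtimes>\<^bsub>k\<^esub> P)"
    if "u \<in> carrier (N \<boxtimes>\<^bsub>k\<^esub> P)" for u
  proof (rule module_hom_tensor_parameter [OF mods(2,3,1) Q _ _ that])
    fix y z assume yz: "y \<in> carrier N" "z \<in> carrier P"
    have "(\<lambda>x. tensor k (M \<boxtimes>\<^bsub>k\<^esub> N) P (tensor k M N x y) z) \<in> module_hom k M ((M \<boxtimes>\<^bsub>k\<^esub> N) \<boxtimes>\<^bsub>k\<^esub> P)"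
      using yz mods MN
      by (auto intro!: module_hom_lambda_comp [OF tensor_hom_left tensor_hom_left])
    then show "(\<lambda>x. ?H x (tensor k N P y z)) \<in> module_hom k M ((M \<boxtimes>\<^bsub>k\<^esub> N) \<boxtimes>\<^bsub>k\<^esub> P)"
      using lift(2) yz mods unfolding module_hom_def by (simp add: Pi_iff MNP.M.a_closed)
  qed (rule lift(1))
  have "bilinear_map k M (N \<boxtimes>\<^bsub>k\<^esub> P) ((M \<boxtimes>\<^bsub>k\<^esub> N) \<boxtimes>\<^bsub>k\<^esub> P) ?H"
    unfolding bilinear_map_def using lift(1) param by simp
  note outer = MNP.bilinear_lift_tensor [OF MN mods(3) this]
  show "assoc_inv k M N P \<in> module_hom k (M \<boxtimes>\<^bsub>k\<^esub> (N \<boxtimes>\<^bsub>k\<^esub> P)) ((M \<boxtimes>\<^bsub>k\<^esub> N) \<boxtimes>\<^bsub>k\<^esub> P)"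
    using outer(1) by (simp add: assoc_inv_def Let_def)
  show "assoc_inv k M N P (tensor k M (N \<boxtimes>\<^bsub>k\<^esub> P) x (tensor k N P y z))
      = tensor k (M \<boxtimes>\<^bsub>k\<^esub> N) P (tensor k M N x y) z"
    if "x \<in> carrier M" "y \<in> carrier N" "z \<in> carrier P"
    using outer(2) [of x "tensor k N P y z"] lift(2) that by (simp add: assoc_inv_def Let_def)
qed

lemma assoc_inv_assoc:
  assumes "module k M" "module k N" "module k P"
  shows "assoc_inv k M N P \<circ> assoc k M N P \<doteq>\<^bsub>(M \<boxtimes>\<^bsub>k\<^esub> N) \<boxtimes>\<^bsub>k\<^esub> P\<^esub> id"
  by (rule hom_tensor3_left_eqI [OF assms module_hom_comp [OF assoc_hom assoc_inv_hom] module_hom_id])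
    (use assms in \<open>simp_all add: assoc_tensor assoc_inv_tensor\<close>)

lemma
  assumes "module k M"
  shows lunit_hom: "lunit k M \<in> module_hom k (scalars k \<boxtimes>\<^bsub>k\<^esub> M) M"
    and lunit_tensor: "r \<in> carrier k \<Longrightarrow> x \<in> carrier M \<Longrightarrow>
       lunit k M (tensor k (scalars k) M r x) = r \<odot>\<^bsub>M\<^esub> x"
proof -
  interpret M: module k M by (rule assms)
  have S: "module k (scalars k)" by (rule module_scalars) (rule M.R.is_cring)
  have "bilinear_map k (scalars k) M M (\<lambda>r x. r \<odot>\<^bsub>M\<^esub> x)"
    by (simp add: bilinear_map_def module_hom_def M.smult_l_distr M.smult_r_distr
        M.smult_assoc1 [symmetric] M.R.m_comm)
  then show "lunit k M \<in> module_hom k (scalars k \<boxtimes>\<^bsub>k\<^esub> M) M"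
    and "r \<in> carrier k \<Longrightarrow> x \<in> carrier M \<Longrightarrow> lunit k M (tensor k (scalars k) M r x) = r \<odot>\<^bsub>M\<^esub> x"
    using module_pair.bilinear_lift_group [of k "scalars k" M M] assms S
    by (auto simp: lunit_def module_pair_def)
qed

lemma
  assumes "module k M"
  shows runit_hom: "runit k M \<in> module_hom k (M \<boxtimes>\<^bsub>k\<^esub> scalars k) M"
    and runit_tensor: "r \<in> carrier k \<Longrightarrow> x \<in> carrier M \<Longrightarrow>
       runit k M (tensor k M (scalars k) x r) = r \<odot>\<^bsub>M\<^esub> x"
proof -
  interpret M: module k M by (rule assms)
  have S: "module k (scalars k)" by (rule module_scalars) (rule M.R.is_cring)
  have "bilinear_map k M (scalars k) M (\<lambda>x r. r \<odot>\<^bsub>M\<^esub> x)"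
    by (simp add: bilinear_map_def module_hom_def M.smult_l_distr M.smult_r_distr
        M.smult_assoc1 [symmetric] M.R.m_comm)
  then show "runit k M \<in> module_hom k (M \<boxtimes>\<^bsub>k\<^esub> scalars k) M"
    and "r \<in> carrier k \<Longrightarrow> x \<in> carrier M \<Longrightarrow> runit k M (tensor k M (scalars k) x r) = r \<odot>\<^bsub>M\<^esub> x"
    using module_pair.bilinear_lift_group [of k M "scalars k" M] assms S
    by (auto simp: runit_def module_pair_def)
qed

section \<open>Frobenius algebras\<close>

context commutative_frobenius_algebra
begin

abbreviation S where "S \<equiv> scalars k"
abbreviation T where "T \<equiv> A \<boxtimes> A"
abbreviation \<mu> where "\<mu> \<equiv> mult_map A"
abbreviation \<Delta> where "\<Delta> \<equiv> comult_map k A \<gamma>"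
abbreviation \<Gamma> where "\<Gamma> \<equiv> \<gamma> \<one>\<^bsub>k\<^esub>"
abbreviation la where "la \<equiv> left_action2 k A A \<mu>"
abbreviation ra where "ra \<equiv> right_action2 k A A \<mu>"
abbreviation lact (infixr \<open>\<rhd>\<close> 75) where "x \<rhd> t \<equiv> la (tensor k A T x t)"
abbreviation ract (infixl \<open>\<lhd>\<close> 75) where "t \<lhd> x \<equiv> ra (tensor k T A t x)"

lemma mods: "module k A" "module k S" "module k T"
  by (auto intro!: module module_scalars R_cring module_tensor)

lemma A_closed: "x \<in> carrier A \<Longrightarrow> y \<in> carrier A \<Longrightarrow> x \<otimes>\<^bsub>A\<^esub> y \<in> carrier A" "\<one>\<^bsub>A\<^esub> \<in> carrier A"
  and A_assoc: "x \<in> carrier A \<Longrightarrow> y \<in> carrier A \<Longrightarrow> z \<in> carrier A \<Longrightarrow>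
    x \<otimes>\<^bsub>A\<^esub> y \<otimes>\<^bsub>A\<^esub> z = x \<otimes>\<^bsub>A\<^esub> (y \<otimes>\<^bsub>A\<^esub> z)"
  and A_comm: "x \<in> carrier A \<Longrightarrow> y \<in> carrier A \<Longrightarrow> x \<otimes>\<^bsub>A\<^esub> y = y \<otimes>\<^bsub>A\<^esub> x"
  and A_lcomm: "x \<in> carrier A \<Longrightarrow> y \<in> carrier A \<Longrightarrow> z \<in> carrier A \<Longrightarrow>
    x \<otimes>\<^bsub>A\<^esub> (y \<otimes>\<^bsub>A\<^esub> z) = y \<otimes>\<^bsub>A\<^esub> (x \<otimes>\<^bsub>A\<^esub> z)"
  and A_distrib: "x \<in> carrier A \<Longrightarrow> y \<in> carrier A \<Longrightarrow> z \<in> carrier A \<Longrightarrow>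
    (x \<oplus>\<^bsub>A\<^esub> y) \<otimes>\<^bsub>A\<^esub> z = x \<otimes>\<^bsub>A\<^esub> z \<oplus>\<^bsub>A\<^esub> y \<otimes>\<^bsub>A\<^esub> z"
  and A_one: "x \<in> carrier A \<Longrightarrow> \<one>\<^bsub>A\<^esub> \<otimes>\<^bsub>A\<^esub> x = x" "x \<in> carrier A \<Longrightarrow> x \<otimes>\<^bsub>A\<^esub> \<one>\<^bsub>A\<^esub> = x"
  by (simp_all add: cring.cring_simprules [OF M_cring])

lemma mult_right_hom: "x \<in> carrier A \<Longrightarrow> (\<lambda>y. x \<otimes>\<^bsub>A\<^esub> y) \<in> module_hom k A A"
  by (rule module_homI)
    (simp_all add: A_closed A_comm [of x] smult_assoc2 A_distrib)

lemma mult_left_hom: "y \<in> carrier A \<Longrightarrow> (\<lambda>x. x \<otimes>\<^bsub>A\<^esub> y) \<in> module_hom k A A"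
  by (rule module_homI) (simp_all add: A_closed smult_assoc2 A_distrib)

lemma mult_map_hom: "\<mu> \<in> module_hom k T A"
  and mult_map_tensor: "x \<in> carrier A \<Longrightarrow> y \<in> carrier A \<Longrightarrow> \<mu> (tensor k A A x y) = x \<otimes>\<^bsub>A\<^esub> y"
proof -
  interpret AA: module_pair k A A by (simp add: module_pair_def mods)
  have "bilinear_map k A A A (\<lambda>x y. x \<otimes>\<^bsub>A\<^esub> y)"
    by (simp add: bilinear_map_def mult_left_hom mult_right_hom)
  note lift = AA.bilinear_lift_group [OF mods(1) this]
  show "\<mu> \<in> module_hom k T A"
    using lift(1) by (simp add: mult_map_def)
  show "\<mu> (tensor k A A x y) = x \<otimes>\<^bsub>A\<^esub> y" if "x \<in> carrier A" "y \<in> carrier A"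
    using lift(2) that by (simp add: mult_map_def)
qed

lemma unit_map_hom: "unit_map A \<in> module_hom k S A"
  by (rule module_homI) (auto simp: unit_map_def A_closed smult_l_distr smult_assoc1)

lemma pairing_map_hom: "pairing_map A \<epsilon> \<in> module_hom k T S"
  unfolding pairing_map_def by (rule module_hom_comp [OF mult_map_hom counit_hom])

lemma lunit_inv_hom: "lunit_inv k A \<in> module_hom k A (S \<boxtimes> A)"
  unfolding lunit_inv_def using tensor_hom_right [OF mods(2,1)] by simp

lemma runit_inv_hom: "runit_inv k A \<in> module_hom k A (A \<boxtimes> S)"
  unfolding runit_inv_def using tensor_hom_left [OF mods(1,2)] by simp

lemmas hom_rules = mods module_tensor module_hom_comp module_hom_id tensor_map_hom tensor_swap_hom
  assoc_hom assoc_inv_hom lunit_hom runit_hom lunit_inv_hom runit_inv_hom mult_map_hom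
  unit_map_hom pairing_map_hom counit_hom copairing_hom tensor_hom_right tensor_hom_left

lemma comult_map_hom: "\<Delta> \<in> module_hom k A T"
  unfolding comult_map_def by (rule hom_rules)+

lemma la_hom: "la \<in> module_hom k (A \<boxtimes> T) T"
  unfolding left_action2_def by (rule hom_rules)+

lemma ra_hom: "ra \<in> module_hom k (T \<boxtimes> A) T"
  unfolding right_action2_def by (rule hom_rules)+

lemmas frob_hom_rules = hom_rules comult_map_hom la_hom ra_hom

lemma copairing_closed: "\<Gamma> \<in> carrier T"
  using module_hom_closed [OF copairing_hom] by simp

lemma counit_closed: "x \<in> carrier A \<Longrightarrow> \<epsilon> x \<in> carrier k"
  using module_hom_closed [OF counit_hom] by simp

lemmas calc_simps = tensor_in_carrier mods mult_map_hom module_hom_id mult_map_tensor A_closed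
  tensor_map_tensor assoc_tensor assoc_inv_tensor copairing_closed counit_closed
  unit_map_hom pairing_map_hom counit_hom copairing_hom comult_map_hom la_hom ra_hom
  lunit_tensor runit_tensor tensor_swap_tensor module_tensor

lemma la_tensor:
  "x \<in> carrier A \<Longrightarrow> a \<in> carrier A \<Longrightarrow> b \<in> carrier A \<Longrightarrow>
     x \<rhd> tensor k A A a b = tensor k A A (x \<otimes>\<^bsub>A\<^esub> a) b"
  by (simp add: left_action2_def calc_simps)

lemma ra_tensor:
  "x \<in> carrier A \<Longrightarrow> a \<in> carrier A \<Longrightarrow> b \<in> carrier A \<Longrightarrow>
     tensor k A A a b \<lhd> x = tensor k A A a (b \<otimes>\<^bsub>A\<^esub> x)"
  by (simp add: right_action2_def calc_simps)

lemma la_closed: "x \<in> carrier A \<Longrightarrow> t \<in> carrier T \<Longrightarrow> x \<rhd> t \<in> carrier T"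
  by (rule module_hom_closed [OF la_hom]) (simp add: calc_simps)

lemma pairing_tensor:
  "x \<in> carrier A \<Longrightarrow> y \<in> carrier A \<Longrightarrow> pairing_map A \<epsilon> (tensor k A A x y) = \<epsilon> (x \<otimes>\<^bsub>A\<^esub> y)"
  by (simp add: pairing_map_def mult_map_tensor)

text \<open>
  An identity in \<open>t\<close> is proved as an equation between two composites of linear maps applied to
  \<open>t\<close>; the composites \<open>la \<circ> tensor k A T x\<close> and \<open>ra \<circ> (\<lambda>t. tensor k T A t x)\<close> are the maps
  \<open>t \<mapsto> x \<rhd> t\<close> and \<open>t \<mapsto> t \<lhd> x\<close>.
\<close>

lemma lact_lact:
  assumes "x \<in> carrier A" "y \<in> carrier A" "t \<in> carrier T"
  shows "x \<rhd> y \<rhd> t = (x \<otimes>\<^bsub>A\<^esub> y) \<rhd> t"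
proof -
  have "la \<circ> tensor k A T x \<circ> (la \<circ> tensor k A T y) \<doteq>\<^bsub>T\<^esub> la \<circ> tensor k A T (x \<otimes>\<^bsub>A\<^esub> y)"
    by (rule hom_tensor_eqI [where P = T])
      ((rule frob_hom_rules | simp add: assms la_tensor A_assoc A_closed)+)
  from map_eqD [OF this assms(3)] show ?thesis by simp
qed

lemma ract_ract:
  assumes "x \<in> carrier A" "y \<in> carrier A" "t \<in> carrier T"
  shows "t \<lhd> x \<lhd> y = t \<lhd> (x \<otimes>\<^bsub>A\<^esub> y)"
proof -
  have "ra \<circ> (\<lambda>t. tensor k T A t y) \<circ> (ra \<circ> (\<lambda>t. tensor k T A t x)) \<doteq>\<^bsub>T\<^esub> ra \<circ> (\<lambda>t. tensor k T A t (x \<otimes>\<^bsub>A\<^esub> y))"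
    by (rule hom_tensor_eqI [where P = T])
      ((rule frob_hom_rules | simp add: assms ra_tensor A_assoc A_closed)+)
  from map_eqD [OF this assms(3)] show ?thesis by simp
qed

lemma lact_one:
  assumes "t \<in> carrier T" shows "\<one>\<^bsub>A\<^esub> \<rhd> t = t"
proof -
  have "la \<circ> tensor k A T \<one>\<^bsub>A\<^esub> \<doteq>\<^bsub>T\<^esub> id"
    by (rule hom_tensor_eqI [where P = T])
      ((rule frob_hom_rules | simp add: la_tensor A_one A_closed)+)
  from map_eqD [OF this assms] show ?thesis by simp
qed

lemma ract_one:
  assumes "t \<in> carrier T" shows "t \<lhd> \<one>\<^bsub>A\<^esub> = t"
proof -
  have "ra \<circ> (\<lambda>t. tensor k T A t \<one>\<^bsub>A\<^esub>) \<doteq>\<^bsub>T\<^esub> id"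
    by (rule hom_tensor_eqI [where P = T])
      ((rule frob_hom_rules | simp add: ra_tensor A_one A_closed)+)
  from map_eqD [OF this assms] show ?thesis by simp
qed

lemma swap_lact:
  assumes "x \<in> carrier A" "t \<in> carrier T"
  shows "tensor_swap k A A (x \<rhd> t) = tensor_swap k A A t \<lhd> x"
proof -
  have "tensor_swap k A A \<circ> (la \<circ> tensor k A T x) \<doteq>\<^bsub>T\<^esub> ra \<circ> (\<lambda>t. tensor k T A t x) \<circ> tensor_swap k A A"
    by (rule hom_tensor_eqI [where P = T])
      ((rule frob_hom_rules | simp add: assms la_tensor ra_tensor calc_simps A_comm)+)
  from map_eqD [OF this assms(2)] show ?thesis by simp
qed

lemma mult_ract:
  assumes "x \<in> carrier A" "t \<in> carrier T"
  shows "\<mu> (t \<lhd> x) = \<mu> t \<otimes>\<^bsub>A\<^esub> x"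
proof -
  have "\<mu> \<circ> (ra \<circ> (\<lambda>t. tensor k T A t x)) \<doteq>\<^bsub>T\<^esub> (\<lambda>a. a \<otimes>\<^bsub>A\<^esub> x) \<circ> \<mu>"
    by (rule hom_tensor_eqI [where P = A])
      ((rule frob_hom_rules mult_left_hom | simp add: assms ra_tensor calc_simps A_assoc)+)
  from map_eqD [OF this assms(2)] show ?thesis by simp
qed

lemma comult_lact:
  assumes "x \<in> carrier A"
  shows "\<Delta> x = x \<rhd> \<Gamma>"
  using assms by (simp add: comult_map_def left_action2_def runit_inv_def calc_simps)


subsection \<open>The two contractions of the pairing with a tensor\<close>

text \<open>
  With \<open>t = \<Sum>\<^sub>i a\<^sub>i \<otimes> b\<^sub>i\<close>, the left contraction sends \<open>x \<otimes> t\<close> to \<open>\<Sum>\<^sub>i \<epsilon> (x a\<^sub>i) b\<^sub>i\<close>, and the right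
  contraction sends \<open>t \<otimes> x\<close> to \<open>\<Sum>\<^sub>i \<epsilon> (b\<^sub>i x) a\<^sub>i\<close>. The snake equations say that at \<open>t = \<Gamma>\<close> both
  return \<open>x\<close>.
\<close>

definition left_contraction where
  "left_contraction = lunit k A \<circ> tensor_map k S A (pairing_map A \<epsilon>) id \<circ> assoc_inv k A A A"
definition right_contraction where
  "right_contraction = runit k A \<circ> tensor_map k A S id (pairing_map A \<epsilon>) \<circ> assoc k A A A"

lemma left_contraction_hom: "left_contraction \<in> module_hom k (A \<boxtimes> T) A"
  unfolding left_contraction_def by (rule hom_rules)+

lemma right_contraction_hom: "right_contraction \<in> module_hom k (T \<boxtimes> A) A"
  unfolding right_contraction_def by (rule hom_rules)+

lemmas contraction_hom_rules = frob_hom_rules left_contraction_hom right_contraction_hom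

lemma left_contraction_tensor:
  assumes "x \<in> carrier A" "a \<in> carrier A" "b \<in> carrier A"
  shows "left_contraction (tensor k A T x (tensor k A A a b)) = \<epsilon> (x \<otimes>\<^bsub>A\<^esub> a) \<odot>\<^bsub>A\<^esub> b"
  using assms by (simp add: left_contraction_def calc_simps pairing_tensor)

lemma right_contraction_tensor:
  assumes "x \<in> carrier A" "a \<in> carrier A" "b \<in> carrier A"
  shows "right_contraction (tensor k T A (tensor k A A a b) x) = \<epsilon> (b \<otimes>\<^bsub>A\<^esub> x) \<odot>\<^bsub>A\<^esub> a"
  using assms by (simp add: right_contraction_def calc_simps pairing_tensor)

lemma left_contraction_copairing: "x \<in> carrier A \<Longrightarrow> left_contraction (tensor k A T x \<Gamma>) = x"
  using map_eqD [OF snake_left] by (simp add: left_contraction_def calc_simps runit_inv_def)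

lemma right_contraction_copairing: "x \<in> carrier A \<Longrightarrow> right_contraction (tensor k T A \<Gamma> x) = x"
  using map_eqD [OF snake_right] by (simp add: right_contraction_def calc_simps lunit_inv_def)

lemma left_contraction_lact:
  assumes "x \<in> carrier A" "y \<in> carrier A" "t \<in> carrier T"
  shows "left_contraction (tensor k A T x (y \<rhd> t)) = left_contraction (tensor k A T (x \<otimes>\<^bsub>A\<^esub> y) t)"
proof -
  have "left_contraction \<circ> tensor k A T x \<circ> (la \<circ> tensor k A T y) \<doteq>\<^bsub>T\<^esub> left_contraction \<circ> tensor k A T (x \<otimes>\<^bsub>A\<^esub> y)"
    by (rule hom_tensor_eqI [where P = A])
      ((rule contraction_hom_rules
        | simp add: assms left_contraction_tensor la_tensor A_assoc A_closed)+)
  from map_eqD [OF this assms(3)] show ?thesis by simp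
qed

lemma right_contraction_swap:
  assumes "x \<in> carrier A" "t \<in> carrier T"
  shows "right_contraction (tensor k T A (tensor_swap k A A t) x) = left_contraction (tensor k A T x t)"
proof -
  have "right_contraction \<circ> (\<lambda>t. tensor k T A t x) \<circ> tensor_swap k A A \<doteq>\<^bsub>T\<^esub> left_contraction \<circ> tensor k A T x"
    by (rule hom_tensor_eqI [where P = A])
      ((rule contraction_hom_rules
        | simp add: assms left_contraction_tensor right_contraction_tensor tensor_swap_tensor mods A_comm)+)
  from map_eqD [OF this assms(2)] show ?thesis by simp
qed

text \<open>
  On \<open>(p \<otimes> q) \<otimes> (a \<otimes> b)\<close> both sides contract \<open>q\<close> with \<open>a\<close>; the scalar \<open>\<epsilon> (q a)\<close> ends up at \<open>p\<close> on
  the left and at \<open>b\<close> on the right, which is the same in \<open>A \<otimes> A\<close>.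
\<close>

lemma pairing_slide:
  "tensor_map k A A right_contraction id \<circ> assoc_inv k T A A
     \<doteq>\<^bsub>T \<boxtimes> T\<^esub> tensor_map k A A id left_contraction \<circ> assoc k A A T"
  by (rule hom_tensor4_eqI [where Q = T])
    ((rule contraction_hom_rules
      | simp add: left_contraction_tensor right_contraction_tensor
        left_contraction_hom right_contraction_hom calc_simps tensor_smult)+)

text \<open>
  The slide is evaluated at \<open>u \<otimes> (x \<rhd> \<Gamma>)\<close>. Contracting with \<open>u\<close> is the identity by assumption and
  leaves \<open>x \<rhd> \<Gamma>\<close>. Contracting with \<open>x \<rhd> \<Gamma>\<close> multiplies by \<open>x\<close>, by the snake equation for \<open>\<Gamma>\<close>, and
  leaves \<open>u \<lhd> x\<close>. The element \<open>u\<close> is kept general because it will be both \<open>\<Gamma>\<close> and its transpose.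
\<close>

lemma pairing_slide_eval:
  assumes u: "u \<in> carrier T" and x: "x \<in> carrier A"
    and Qu: "\<And>y. y \<in> carrier A \<Longrightarrow> right_contraction (tensor k T A u y) = y"
  shows "u \<lhd> x = x \<rhd> \<Gamma>"
proof -
  have "tensor_map k A A right_contraction id \<circ> assoc_inv k T A A \<circ> tensor k T T u \<doteq>\<^bsub>T\<^esub> id"
    by (rule hom_tensor_eqI [where P = T])
      ((rule contraction_hom_rules | simp add: u Qu right_contraction_hom calc_simps)+)
  from map_eqD [OF this la_closed [OF x copairing_closed]]
  have 1: "(tensor_map k A A right_contraction id \<circ> assoc_inv k T A A) (tensor k T T u (x \<rhd> \<Gamma>)) = x \<rhd> \<Gamma>"
    by simp
  have "tensor_map k A A id left_contraction \<circ> assoc k A A T \<circ> (\<lambda>t. tensor k T T t (x \<rhd> \<Gamma>))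
      \<doteq>\<^bsub>T\<^esub> ra \<circ> (\<lambda>t. tensor k T A t x)"
    by (rule hom_tensor_eqI [where P = T])
      ((rule contraction_hom_rules
        | simp add: x left_contraction_hom left_contraction_lact left_contraction_copairing
            calc_simps la_closed ra_tensor)+)
  from map_eqD [OF this u]
  have 2: "(tensor_map k A A id left_contraction \<circ> assoc k A A T) (tensor k T T u (x \<rhd> \<Gamma>)) = u \<lhd> x"
    by simp
  have "tensor k T T u (x \<rhd> \<Gamma>) \<in> carrier (T \<boxtimes> T)"
    by (simp add: calc_simps u x la_closed)
  from map_eqD [OF pairing_slide this] show ?thesis
    unfolding 1 2 by simp
qed

lemma comult_ract: "x \<in> carrier A \<Longrightarrow> \<Delta> x = \<Gamma> \<lhd> x"
  using pairing_slide_eval [OF copairing_closed _ right_contraction_copairing] by (simp add: comult_lact)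

lemma copairing_symmetric: "tensor_swap k A A \<Gamma> = \<Gamma>"
proof -
  have swap: "tensor_swap k A A \<Gamma> \<in> carrier T"
    by (rule module_hom_closed [OF tensor_swap_hom]) (simp_all add: calc_simps)
  have "tensor_swap k A A \<Gamma> \<lhd> \<one>\<^bsub>A\<^esub> = \<one>\<^bsub>A\<^esub> \<rhd> \<Gamma>"
    by (rule pairing_slide_eval [OF swap])
      (simp_all add: right_contraction_swap left_contraction_copairing copairing_closed A_closed)
  then show ?thesis
    by (simp add: ract_one swap lact_one copairing_closed)
qed

subsection \<open>The algebra as a bimodule and a bicomodule over itself\<close>

lemma mult_assoc_eq:
  "\<mu> \<circ> tensor_map k A A \<mu> id \<doteq>\<^bsub>T \<boxtimes> A\<^esub> \<mu> \<circ> tensor_map k A A id \<mu> \<circ> assoc k A A A"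
  by (rule hom_tensor3_left_eqI [where Q = A])
    ((rule frob_hom_rules | simp add: calc_simps A_assoc)+)

lemma mult_comm_eq: "\<mu> \<circ> tensor_swap k A A \<doteq>\<^bsub>T\<^esub> \<mu>"
  by (rule hom_tensor_eqI [where P = A]) ((rule frob_hom_rules | simp add: calc_simps A_comm)+)

lemma mult_unit_left_eq: "\<mu> \<circ> tensor_map k A A (unit_map A) id \<circ> lunit_inv k A \<doteq>\<^bsub>A\<^esub> id"
  by (simp add: map_eq_def lunit_inv_def calc_simps unit_map_def A_one)

lemma mult_unit_right_eq: "\<mu> \<circ> tensor_map k A A id (unit_map A) \<circ> runit_inv k A \<doteq>\<^bsub>A\<^esub> id"
  by (simp add: map_eq_def runit_inv_def calc_simps unit_map_def A_one)

lemma mult_left_linear_eq: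
  "\<mu> \<circ> tensor_map k A A \<mu> id \<circ> assoc_inv k A A A \<doteq>\<^bsub>A \<boxtimes> T\<^esub> \<mu> \<circ> tensor_map k A A id \<mu>"
  by (rule hom_tensor3_right_eqI [where Q = A])
    ((rule frob_hom_rules | simp add: calc_simps A_assoc)+)

text \<open>
  These are the two halves of the Frobenius relation: the first comes from \<open>\<Delta> x = x \<rhd> \<Gamma>\<close>, the
  second from \<open>\<Delta> x = \<Gamma> \<lhd> x\<close>.
\<close>

lemma comult_mult:
  assumes "x \<in> carrier A" "y \<in> carrier A"
  shows "\<Delta> (x \<otimes>\<^bsub>A\<^esub> y) = x \<rhd> \<Delta> y" and "\<Delta> (x \<otimes>\<^bsub>A\<^esub> y) = \<Delta> x \<lhd> y"
  using assms
  by (simp add: comult_lact lact_lact copairing_closed A_closed)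
     (simp add: assms comult_ract ract_ract copairing_closed A_closed)

lemma comult_closed: "x \<in> carrier A \<Longrightarrow> \<Delta> x \<in> carrier T"
  by (rule module_hom_closed [OF comult_map_hom])

lemma frobenius_left_eq:
  "\<Delta> \<circ> \<mu> \<doteq>\<^bsub>T\<^esub> tensor_map k A A id \<mu> \<circ> assoc k A A A \<circ> tensor_map k T A \<Delta> id"
proof (rule hom_tensor_eqI [where P = T])
  fix x y assume "x \<in> carrier A" "y \<in> carrier A"
  then show "(\<Delta> \<circ> \<mu>) (tensor k A A x y) =
      (tensor_map k A A id \<mu> \<circ> assoc k A A A \<circ> tensor_map k T A \<Delta> id) (tensor k A A x y)"
    by (simp add: calc_simps comult_mult(2) right_action2_def)
qed (rule frob_hom_rules)+

lemma frobenius_right_eq: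
  "\<Delta> \<circ> \<mu> \<doteq>\<^bsub>T\<^esub> tensor_map k A A \<mu> id \<circ> assoc_inv k A A A \<circ> tensor_map k A T id \<Delta>"
proof (rule hom_tensor_eqI [where P = T])
  fix x y assume "x \<in> carrier A" "y \<in> carrier A"
  then show "(\<Delta> \<circ> \<mu>) (tensor k A A x y) =
      (tensor_map k A A \<mu> id \<circ> assoc_inv k A A A \<circ> tensor_map k A T id \<Delta>) (tensor k A A x y)"
    by (simp add: calc_simps comult_mult(1) left_action2_def)
qed (rule frob_hom_rules)+

lemma comult_comm_eq: "tensor_swap k A A \<circ> \<Delta> \<doteq>\<^bsub>A\<^esub> \<Delta>"
proof -
  have "tensor_swap k A A (\<Delta> x) = \<Delta> x" if "x \<in> carrier A" for x
    using that swap_lact [OF that copairing_closed]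
    by (simp only: copairing_symmetric flip: comult_lact comult_ract)
  then show ?thesis by (simp add: map_eq_def)
qed

text \<open>
  The analogue of \<open>pairing_slide\<close> for multiplication: on \<open>(a \<otimes> b) \<otimes> (p \<otimes> q)\<close> both sides are
  \<open>a \<otimes> (b p \<otimes> q)\<close>.
\<close>

lemma action_slide:
  "assoc k A A A \<circ> tensor_map k T A ra id \<circ> assoc_inv k T A A
     \<doteq>\<^bsub>T \<boxtimes> T\<^esub> tensor_map k A T id la \<circ> assoc k A A T"
  by (rule hom_tensor4_eqI [where Q = "A \<boxtimes> T"])
    ((rule frob_hom_rules | simp add: calc_simps la_tensor ra_tensor)+)

text \<open>
  At \<open>\<Gamma> \<otimes> \<Delta> x\<close>, one side of \<open>action_slide\<close> applies \<open>p \<mapsto> \<Gamma> \<lhd> p = \<Delta> p\<close> to the first factor of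
  \<open>\<Delta> x\<close>; the other applies \<open>b \<mapsto> b \<rhd> \<Delta> x = \<Delta> (b x)\<close> to the second factor of \<open>\<Gamma>\<close>, and
  \<open>\<Gamma> \<lhd> x = \<Delta> x\<close>.
\<close>

lemma comult_coassoc_eq:
  "assoc k A A A \<circ> tensor_map k T A \<Delta> id \<circ> \<Delta> \<doteq>\<^bsub>A\<^esub> tensor_map k A T id \<Delta> \<circ> \<Delta>"
  unfolding map_eq_def
proof
  fix x assume x: "x \<in> carrier A"
  have "assoc k A A A \<circ> tensor_map k T A ra id \<circ> assoc_inv k T A A \<circ> tensor k T T \<Gamma>
      \<doteq>\<^bsub>T\<^esub> assoc k A A A \<circ> tensor_map k T A \<Delta> id"
    by (rule hom_tensor_eqI [where P = "A \<boxtimes> T"])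
      ((rule frob_hom_rules | simp add: calc_simps comult_ract)+)
  from map_eqD [OF this comult_closed [OF x]]
  have 1: "(assoc k A A A \<circ> tensor_map k T A ra id \<circ> assoc_inv k T A A) (tensor k T T \<Gamma> (\<Delta> x))
      = (assoc k A A A \<circ> tensor_map k T A \<Delta> id \<circ> \<Delta>) x"
    by simp
  have "tensor_map k A T id la \<circ> assoc k A A T \<circ> (\<lambda>t. tensor k T T t (\<Delta> x))
      \<doteq>\<^bsub>T\<^esub> tensor_map k A T id \<Delta> \<circ> (ra \<circ> (\<lambda>t. tensor k T A t x))"
    by (rule hom_tensor_eqI [where P = "A \<boxtimes> T"])
      ((rule frob_hom_rules | simp add: x calc_simps comult_closed comult_mult(1) ra_tensor)+)
  from map_eqD [OF this copairing_closed]
  have 2: "(tensor_map k A T id la \<circ> assoc k A A T) (tensor k T T \<Gamma> (\<Delta> x))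
      = (tensor_map k A T id \<Delta> \<circ> \<Delta>) x"
    by (simp add: comult_ract x)
  have "tensor k T T \<Gamma> (\<Delta> x) \<in> carrier (T \<boxtimes> T)"
    by (simp add: calc_simps x comult_closed)
  from map_eqD [OF action_slide this]
  show "(assoc k A A A \<circ> tensor_map k T A \<Delta> id \<circ> \<Delta>) x = (tensor_map k A T id \<Delta> \<circ> \<Delta>) x"
    unfolding 1 2 .
qed

lemma comult_coassoc_inv_eq:
  "assoc_inv k A A A \<circ> tensor_map k A T id \<Delta> \<circ> \<Delta> \<doteq>\<^bsub>A\<^esub> tensor_map k T A \<Delta> id \<circ> \<Delta>"
  unfolding map_eq_def
proof
  fix x assume x: "x \<in> carrier A"
  have "tensor_map k T A \<Delta> id (\<Delta> x) \<in> carrier (T \<boxtimes> A)"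
    by (rule module_hom_closed [OF tensor_map_hom [OF comult_map_hom module_hom_id mods(1,1,3,1)]])
      (rule comult_closed [OF x])
  from map_eqD [OF assoc_inv_assoc [OF mods(1,1,1)] this] map_eqD [OF comult_coassoc_eq x]
  show "(assoc_inv k A A A \<circ> tensor_map k A T id \<Delta> \<circ> \<Delta>) x = (tensor_map k T A \<Delta> id \<circ> \<Delta>) x"
    by simp
qed

lemma comult_counit_left_eq:
  "lunit k A \<circ> tensor_map k S A \<epsilon> id \<circ> \<Delta> \<doteq>\<^bsub>A\<^esub> id"
  unfolding map_eq_def
proof
  fix x assume x: "x \<in> carrier A"
  have "lunit k A \<circ> tensor_map k S A \<epsilon> id \<circ> (la \<circ> tensor k A T x) \<doteq>\<^bsub>T\<^esub> left_contraction \<circ> tensor k A T x"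
    by (rule hom_tensor_eqI [where P = A])
      ((rule contraction_hom_rules | simp add: x calc_simps la_tensor left_contraction_tensor)+)
  from map_eqD [OF this copairing_closed] show "(lunit k A \<circ> tensor_map k S A \<epsilon> id \<circ> \<Delta>) x = id x"
    by (simp add: comult_lact x left_contraction_copairing)
qed

lemma comult_counit_right_eq:
  "runit k A \<circ> tensor_map k A S id \<epsilon> \<circ> \<Delta> \<doteq>\<^bsub>A\<^esub> id"
  unfolding map_eq_def
proof
  fix x assume x: "x \<in> carrier A"
  have "runit k A \<circ> tensor_map k A S id \<epsilon> \<circ> (ra \<circ> (\<lambda>t. tensor k T A t x)) \<doteq>\<^bsub>T\<^esub> right_contraction \<circ> (\<lambda>t. tensor k T A t x)"
    by (rule hom_tensor_eqI [where P = A])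
      ((rule contraction_hom_rules | simp add: x calc_simps ra_tensor right_contraction_tensor)+)
  from map_eqD [OF this copairing_closed] show "(runit k A \<circ> tensor_map k A S id \<epsilon> \<circ> \<Delta>) x = id x"
    by (simp add: comult_ract x right_contraction_copairing)
qed

lemma mult_from_comult_eq:
  "lunit k A \<circ> tensor_map k S A (pairing_map A \<epsilon>) id \<circ> assoc_inv k A A A \<circ> tensor_map k A T id \<Delta> \<doteq>\<^bsub>T\<^esub> \<mu>"
proof -
  have "left_contraction \<circ> tensor_map k A T id \<Delta> \<doteq>\<^bsub>T\<^esub> \<mu>"
    by (rule hom_tensor_eqI [where P = A])
      ((rule contraction_hom_rules
        | simp add: calc_simps comult_lact left_contraction_lact left_contraction_copairing)+)
  then show ?thesis
    by (simp only: left_contraction_def)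
qed

lemma comult_from_mult_eq:
  "tensor_map k A A id \<mu> \<circ> assoc k A A A \<circ> tensor_map k T A \<gamma> id \<circ> lunit_inv k A \<doteq>\<^bsub>A\<^esub> \<Delta>"
  by (simp add: map_eq_def comult_ract lunit_inv_def calc_simps right_action2_def)

lemmas self_equations = mult_map_hom comult_map_hom mult_assoc_eq mult_comm_eq mult_unit_left_eq
  mult_unit_right_eq mult_left_linear_eq frobenius_left_eq frobenius_right_eq comult_comm_eq
  comult_coassoc_eq comult_coassoc_inv_eq comult_counit_left_eq comult_counit_right_eq
  mult_from_comult_eq comult_from_mult_eq

lemmas self_laws = self_equations self_equations(3-) [THEN map_eq_sym] map_eq_refl

text \<open>
  After unfolding, every axiom is one of the laws above, up to the orientation of the equation and
  the bracketing of the composites.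
\<close>

theorem self_pair: "commutative_frobenius_pair k A \<epsilon> \<gamma> A \<mu> \<mu> \<Delta> \<Delta> \<mu> \<Delta> \<mu> \<Delta>"
  by unfold_locales
   (unfold bimodule_map_def bicomodule_map_def left_action2_def right_action2_def
      left_coaction2_def right_coaction2_def o_assoc,
    (intro conjI self_laws)+)

subsection \<open>Multiplication by a square root of the handle element\<close>

context
  fixes \<xi>
  assumes xi: "\<xi> \<in> carrier A" and xi_square: "\<xi> \<otimes>\<^bsub>A\<^esub> \<xi> = handle_element k A \<gamma>"
begin

abbreviation \<nu> where "\<nu> \<equiv> \<lambda>x. \<xi> \<otimes>\<^bsub>A\<^esub> x"

lemma nu_hom: "\<nu> \<in> module_hom k A A"
  by (rule mult_right_hom [OF xi])

text \<open>
  The map \<open>\<mu>\<Delta>\<close> is \<open>A\<close>-linear, hence multiplication by its value \<open>\<phi>\<close> at \<open>1\<close>.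
\<close>

lemma nu_nu_eq: "\<nu> \<circ> \<nu> \<doteq>\<^bsub>A\<^esub> \<mu> \<circ> \<Delta>"
  unfolding map_eq_def
proof
  fix x assume x: "x \<in> carrier A"
  have "\<mu> (\<Delta> x) = \<mu> (\<Delta> \<one>\<^bsub>A\<^esub> \<lhd> x)"
    using comult_mult(2) [OF A_closed(2) x] by (simp add: A_one x)
  also have "\<dots> = \<xi> \<otimes>\<^bsub>A\<^esub> \<xi> \<otimes>\<^bsub>A\<^esub> x"
    by (simp add: mult_ract x comult_closed A_closed xi_square handle_element_def)
  finally show "(\<nu> \<circ> \<nu>) x = (\<mu> \<circ> \<Delta>) x"
    by (simp add: A_assoc xi x)
qed

lemma mult_nu_left_eq: "\<mu> \<circ> tensor_map k A A \<nu> id \<doteq>\<^bsub>T\<^esub> \<nu> \<circ> \<mu>"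
  by (rule hom_tensor_eqI [where P = A])
    ((rule frob_hom_rules nu_hom | simp add: calc_simps nu_hom xi A_assoc)+)

lemma mult_nu_right_eq: "\<mu> \<circ> tensor_map k A A id \<nu> \<doteq>\<^bsub>T\<^esub> \<nu> \<circ> \<mu>"
  by (rule hom_tensor_eqI [where P = A])
    ((rule frob_hom_rules nu_hom | simp add: calc_simps nu_hom xi A_lcomm)+)

lemma comult_nu_left_eq: "tensor_map k A A \<nu> id \<circ> \<Delta> \<doteq>\<^bsub>A\<^esub> \<Delta> \<circ> \<nu>"
proof -
  have "tensor_map k A A \<nu> id \<doteq>\<^bsub>T\<^esub> la \<circ> tensor k A T \<xi>"
    by (rule hom_tensor_eqI [where P = T])
      ((rule frob_hom_rules nu_hom | simp add: calc_simps nu_hom xi la_tensor)+)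
  from map_eqD [OF this comult_closed] show ?thesis
    by (simp add: map_eq_def comult_mult(1) xi)
qed

lemma comult_nu_right_eq: "tensor_map k A A id \<nu> \<circ> \<Delta> \<doteq>\<^bsub>A\<^esub> \<Delta> \<circ> \<nu>"
proof -
  have "tensor_map k A A id \<nu> \<doteq>\<^bsub>T\<^esub> ra \<circ> (\<lambda>t. tensor k T A t \<xi>)"
    by (rule hom_tensor_eqI [where P = T])
      ((rule frob_hom_rules nu_hom | simp add: calc_simps nu_hom xi ra_tensor A_comm)+)
  from map_eqD [OF this comult_closed] show ?thesis
    by (simp add: map_eq_def A_comm [OF xi] comult_mult(2) xi)
qed

lemmas nu_equations = nu_hom nu_nu_eq mult_nu_left_eq mult_nu_right_eq comult_nu_left_eq
  comult_nu_right_eq map_eq_refl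
  map_eq_trans [OF mult_nu_left_eq map_eq_sym [OF mult_nu_right_eq]]
  map_eq_trans [OF comult_nu_left_eq map_eq_sym [OF comult_nu_right_eq]]
lemmas nu_laws = nu_equations nu_equations(2-) [THEN map_eq_sym]

theorem self_pair_moebius:
  "commutative_frobenius_pair_moebius k A \<epsilon> \<gamma> A \<mu> \<mu> \<Delta> \<Delta> \<mu> \<Delta> \<mu> \<Delta> \<nu> \<nu> \<nu>"
  by (intro commutative_frobenius_pair_moebius.intro commutative_frobenius_pair_moebius_axioms.intro
      self_pair nu_laws)

end

end

theorem theorem5p6:
  fixes k :: "('k, 'r) ring_scheme"
    and A :: "('k, 'a) module"
    and \<epsilon> :: "'a \<Rightarrow> 'k"
    and \<gamma> :: "'k \<Rightarrow> ('a \<times> 'a \<Rightarrow>\<^sub>0 int) set"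
  assumes "commutative_frobenius_algebra k A \<epsilon> \<gamma>"
    and "\<exists>\<xi> \<in> carrier A. \<xi> \<otimes>\<^bsub>A\<^esub> \<xi> = handle_element k A \<gamma>"
  shows "\<exists>(E :: ('k, 'a) module) \<mu>AEE \<mu>EAE \<Delta>EAE \<Delta>EEA \<mu>EEE \<Delta>EEE \<mu>EEA \<Delta>AEE \<nu>AE \<nu>EA \<nu>EE.
     commutative_frobenius_pair_moebius k A \<epsilon> \<gamma> E
       \<mu>AEE \<mu>EAE \<Delta>EAE \<Delta>EEA \<mu>EEE \<Delta>EEE \<mu>EEA \<Delta>AEE \<nu>AE \<nu>EA \<nu>EE"
proof -
  interpret commutative_frobenius_algebra k A \<epsilon> \<gamma> by (rule assms(1))
  from assms(2) obtain \<xi> where "\<xi> \<in> carrier A" "\<xi> \<otimes>\<^bsub>A\<^esub> \<xi> = handle_element k A \<gamma>" by blast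
  then show ?thesis
    using self_pair_moebius by blast
qed

end
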